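(* Let $\bar X\in\mathcal K$ and $\bar V\in L^2(\Omega)$, and let $\bar\Psi=\Psi[\bar X,\bar V]$. Then there exists a unique $L^2$-gradient flow $X_t:[0,\infty)\to\mathcal K$ for the functional $\bar{\mathcal V}$ with initial data $X_0=\bar X$, and it evolves according to the minimal selection of $\partial\bar{\mathcal V}$, that is, $$-\dot X_t=\partial^\circ\bar{\mathcal V}(X_t)\qquad\text{for a.e. } t>0,$$ where $\partial^\circ\bar{\mathcal V}(X_t)$ is the element of minimal $L^2(\Omega)$-norm of $\partial\bar{\mathcal V}(X_t)$.
   Context: The communication protocol $\phi$ on $\mathbb R$ is nonnegative, symmetric ($\phi(-x)=\phi(x)$), radially nonincreasing (nonincreasing on $(0,\infty)$) and locally integrable; $\Phi(x)=\int_0^x\phi(y)\,dy$ and $W_\Phi(x)=\int_0^x\Phi(y)\,dy$. $\Omega=(0,1)$ with Lebesgue measure; $\langle\cdot,\cdot\rangle$ is the inner product of the real Hilbert space $L^2(\Omega)$. $\mathcal K=\{X\in L^2(\Omega): X\text{ nondecreasing and right-continuous}\}$, a closed convex cone; $I_{\mathcal K}(X)=0$ if $X\in\mathcal K$ and $+\infty$ otherwise. $\Psi[X,V]=V+\int_\Omega\Phi(X-X(\omega))\,d\omega$ for $X\in\mathcal K$, $V\in L^2(\Omega)$. With $\bar\Psi=\Psi[\bar X,\bar V]$ set, for $X\in L^2(\Omega)$, $$\mathcal V(X)=\frac12\iint_{\Omega\times\Omega}W_\Phi(X(m)-X(\omega))\,d\omega\,dm-\int_\Omega\bar\Psi(m)X(m)\,dm,\qquad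 \bar{\mathcal V}(X)=\mathcal V(X)+I_{\mathcal K}(X).$$ For a proper convex functional $\mathcal F$ on $L^2(\Omega)$, $\partial\mathcal F(X)=\{Y\in L^2(\Omega):\mathcal F(Z)-\mathcal F(X)\ge\langle Y,Z-X\rangle\ \forall Z\in L^2(\Omega)\}$. An absolutely continuous curve $X_t:[0,\infty)\to L^2(\Omega)$ is an $L^2$-gradient flow for $\bar{\mathcal V}$ if $-\dot X_t\in\partial\bar{\mathcal V}(X_t)$ for a.e. $t>0$. *)

theory Defs
  imports "HOL-Analysis.Analysis"
begin

section \<open>The real Hilbert space of square-integrable functions on the unit interval\<close>

definition Omega :: "real measure" where
  "Omega = restrict_space lborel {0<..<1}"

definition square_integrable :: "(real \<Rightarrow> real) \<Rightarrow> bool" where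
  "square_integrable f \<longleftrightarrow> f \<in> borel_measurable Omega \<and> integrable Omega (\<lambda>m. (f m)\<^sup>2)"

definition l2_eq :: "(real \<Rightarrow> real) \<Rightarrow> (real \<Rightarrow> real) \<Rightarrow> bool" where
  "l2_eq f g \<longleftrightarrow> square_integrable f \<and> square_integrable g \<and> (AE m in Omega. f m = g m)"

lemma square_integrable_zero: "square_integrable (\<lambda>_. 0)"
  by (simp add: square_integrable_def)

lemma square_integrable_mult:
  assumes "square_integrable f" "square_integrable g"
  shows "integrable Omega (\<lambda>m. f m * g m)"
proof (rule Bochner_Integration.integrable_bound)
  show "integrable Omega (\<lambda>m. (f m)\<^sup>2 + (g m)\<^sup>2)"
    using assms by (simp add: square_integrable_def)
  have f[measurable]: "f \<in> borel_measurable Omega" and g[measurable]: "g \<in> borel_measurable Omega"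
    using assms by (auto simp: square_integrable_def)
  show "(\<lambda>m. f m * g m) \<in> borel_measurable Omega" by measurable
  have "\<bar>a * b\<bar> \<le> a\<^sup>2 + b\<^sup>2" for a b :: real
  proof -
    have "2 * \<bar>a\<bar> * \<bar>b\<bar> \<le> \<bar>a\<bar>\<^sup>2 + \<bar>b\<bar>\<^sup>2" by (rule sum_squares_bound)
    moreover have "0 \<le> \<bar>a\<bar> * \<bar>b\<bar>" by simp
    ultimately show ?thesis by (simp only: abs_mult power2_abs)
  qed
  then show "AE m in Omega. norm (f m * g m) \<le> norm ((f m)\<^sup>2 + (g m)\<^sup>2)"
    by simp
qed

lemma square_integrable_add:
  assumes "square_integrable f" "square_integrable g"
  shows "square_integrable (\<lambda>m. f m + g m)"
  using assms square_integrable_mult[OF assms]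
  by (auto simp: square_integrable_def power2_sum mult.assoc)

lemma square_integrable_scale:
  assumes "square_integrable f"
  shows "square_integrable (\<lambda>m. c * f m)"
  using assms by (auto simp: square_integrable_def power_mult_distrib)

lemma part_equivp_l2_eq: "part_equivp l2_eq"
proof (rule part_equivpI)
  show "\<exists>f. l2_eq f f"
    by (rule exI[of _ "\<lambda>_. 0"]) (simp add: l2_eq_def square_integrable_zero)
  show "symp l2_eq"
    by (rule sympI) (auto simp: l2_eq_def)
  show "transp l2_eq"
    by (rule transpI) (auto simp: l2_eq_def)
qed

quotient_type L2 = "real \<Rightarrow> real" / partial: l2_eq
  by (rule part_equivp_l2_eq)

instantiation L2 :: real_vector
begin

lift_definition zero_L2 :: L2 is "\<lambda>_. 0"
  by (simp add: l2_eq_def square_integrable_zero)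

lift_definition plus_L2 :: "L2 \<Rightarrow> L2 \<Rightarrow> L2" is "\<lambda>f g m. f m + g m"
  by (auto simp: l2_eq_def square_integrable_add elim: AE_mp)

lift_definition scaleR_L2 :: "real \<Rightarrow> L2 \<Rightarrow> L2" is "\<lambda>c f m. c * f m"
  by (auto simp: l2_eq_def square_integrable_scale elim: AE_mp)

definition "uminus_L2 (X :: L2) = (- 1) *\<^sub>R X"

definition "minus_L2 (X :: L2) Y = X + (- Y)"

instance
proof
  fix X Y Z :: L2 and a b :: real
  show "X + Y + Z = X + (Y + Z)"
    by transfer (auto simp: l2_eq_def add.assoc intro!: square_integrable_add)
  show "X + Y = Y + X"
    by transfer (auto simp: l2_eq_def add.commute intro!: square_integrable_add)
  show "0 + X = X"
    by transfer (auto simp: l2_eq_def)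
  show "- X + X = 0"
    unfolding uminus_L2_def
    by transfer (auto simp: l2_eq_def square_integrable_zero)
  show "X - Y = X + - Y"
    by (rule minus_L2_def)
  show "a *\<^sub>R (X + Y) = a *\<^sub>R X + a *\<^sub>R Y"
    by transfer (auto simp: l2_eq_def distrib_left intro!: square_integrable_add square_integrable_scale
        square_integrable_scale[OF square_integrable_add, unfolded distrib_left])
  show "(a + b) *\<^sub>R X = a *\<^sub>R X + b *\<^sub>R X"
    by transfer (auto simp: l2_eq_def distrib_right intro!: square_integrable_add square_integrable_scale)
  show "a *\<^sub>R b *\<^sub>R X = (a * b) *\<^sub>R X"
    by transfer (auto simp: l2_eq_def mult.assoc
        intro: square_integrable_scale square_integrable_scale[of _ "a * b", unfolded mult.assoc])
  show "1 *\<^sub>R X = X"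
    by transfer (auto simp: l2_eq_def)
qed

end

instantiation L2 :: real_inner
begin

lift_definition inner_L2 :: "L2 \<Rightarrow> L2 \<Rightarrow> real" is "\<lambda>f g. \<integral>m. f m * g m \<partial>Omega"
  by (rule integral_cong_AE) (auto simp: l2_eq_def square_integrable_def elim: AE_mp)

definition "norm_L2 (X :: L2) = sqrt (inner X X)"

definition "dist_L2 (X :: L2) Y = norm (X - Y)"

definition "sgn_L2 (X :: L2) = inverse (norm X) *\<^sub>R X"

definition [code del]:
  "uniformity_L2 = (INF e\<in>{0<..}. principal {(X :: L2, Y). dist X Y < e})"

definition [code del]:
  "open_L2 (U :: L2 set) \<longleftrightarrow> (\<forall>X\<in>U. eventually (\<lambda>(X', Y). X' = X \<longrightarrow> Y \<in> U) uniformity)"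

instance
proof
  fix X Y Z :: L2 and r :: real
  show "inner X Y = inner Y X"
    by transfer (simp add: mult.commute)
  show "inner (X + Y) Z = inner X Z + inner Y Z"
    by transfer (simp add: l2_eq_def distrib_right square_integrable_mult)
  show "inner (r *\<^sub>R X) Y = r * inner X Y"
    by transfer (simp add: mult.assoc)
  show "0 \<le> inner X X"
    by transfer simp
  show "inner X X = 0 \<longleftrightarrow> X = 0"
  proof transfer
    fix f assume "l2_eq f f"
    then have f: "square_integrable f" by (simp add: l2_eq_def)
    have "(\<integral>m. f m * f m \<partial>Omega) = 0 \<longleftrightarrow> (AE m in Omega. f m * f m = 0)"
      by (rule integral_nonneg_eq_0_iff_AE) (auto simp: f square_integrable_mult)
    then show "(\<integral>m. f m * f m \<partial>Omega) = 0 \<longleftrightarrow> l2_eq f (\<lambda>_. 0)"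
      by (simp add: l2_eq_def f square_integrable_zero)
  qed
qed (simp_all add: norm_L2_def dist_L2_def sgn_L2_def uniformity_L2_def open_L2_def)

end

text \<open>
  \<^term>\<open>rep_L2 X\<close> is a chosen square-integrable function in the class \<^term>\<open>X\<close>; it plays the role of
  the function values \<open>X(m)\<close>.  All integrals below are insensitive to the choice.  For a function
  that is square integrable, \<^term>\<open>abs_L2 f\<close> is its class.
\<close>

lemma l2_eq_rep_L2: "l2_eq (rep_L2 X) (rep_L2 X)"
  by (rule Quotient3_rep_reflp[OF Quotient3_L2])

lemma abs_L2_rep_L2: "abs_L2 (rep_L2 X) = X"
  by (rule Quotient3_abs_rep[OF Quotient3_L2])

lemma inner_L2_eq_integral: "inner X Y = (\<integral>m. rep_L2 X m * rep_L2 Y m \<partial>Omega)"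
  by (metis abs_L2_rep_L2 inner_L2.abs_eq l2_eq_rep_L2)


section \<open>The cone of monotone maps\<close>

definition monotone_cone :: "L2 set" where
  "monotone_cone = {abs_L2 f | f. square_integrable f \<and> mono_on {0<..<1} f \<and>
     (\<forall>m\<in>{0<..<1}. continuous (at_right m) f)}"

definition indicator_functional :: "L2 set \<Rightarrow> L2 \<Rightarrow> ereal" where
  "indicator_functional K X = (if X \<in> K then 0 else \<infinity>)"


section \<open>The communication protocol and the energy\<close>

text \<open>
  The value \<open>\<phi> 0\<close> is irrelevant, so weakly singular kernels are covered.
\<close>

definition communication_protocol :: "(real \<Rightarrow> real) \<Rightarrow> bool" where
  "communication_protocol \<phi> \<longleftrightarrow>
     (\<forall>x. 0 \<le> \<phi> x) \<and> (\<forall>x. \<phi> (- x) = \<phi> x) \<and> antimono_on {0<..} \<phi> \<and>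
     (\<forall>a b. set_integrable lborel {a..b} \<phi>)"

text \<open>The oriented integral is used, so that \<open>Phi \<phi>\<close> is odd for symmetric \<open>\<phi>\<close>.\<close>

definition Phi :: "(real \<Rightarrow> real) \<Rightarrow> real \<Rightarrow> real" where
  "Phi \<phi> x = (LBINT y=0..x. \<phi> y)"

definition W_Phi :: "(real \<Rightarrow> real) \<Rightarrow> real \<Rightarrow> real" where
  "W_Phi \<phi> x = (LBINT y=0..x. Phi \<phi> y)"

text \<open>
  A communication protocol is bounded away from the origin, so \<open>Phi \<phi>\<close> has at most linear growth and
  the function passed to \<^const>\<open>abs_L2\<close> is square integrable.
\<close>

definition Psi :: "(real \<Rightarrow> real) \<Rightarrow> L2 \<Rightarrow> L2 \<Rightarrow> L2" where
  "Psi \<phi> X V = abs_L2 (\<lambda>m. rep_L2 V m + (\<integral>\<omega>. Phi \<phi> (rep_L2 X m - rep_L2 X \<omega>) \<partial>Omega))"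

definition energy :: "(real \<Rightarrow> real) \<Rightarrow> L2 \<Rightarrow> L2 \<Rightarrow> real" where
  "energy \<phi> \<Psi> X =
     1 / 2 * (\<integral>m. (\<integral>\<omega>. W_Phi \<phi> (rep_L2 X m - rep_L2 X \<omega>) \<partial>Omega) \<partial>Omega)
     - (\<integral>m. rep_L2 \<Psi> m * rep_L2 X m \<partial>Omega)"

definition constrained_energy :: "(real \<Rightarrow> real) \<Rightarrow> L2 \<Rightarrow> L2 \<Rightarrow> ereal" where
  "constrained_energy \<phi> \<Psi> X = ereal (energy \<phi> \<Psi> X) + indicator_functional monotone_cone X"


section \<open>Subdifferentials and gradient flows\<close>

text \<open>
  For proper \<open>F\<close> this is empty at points with \<open>F X = \<infinity>\<close>, since \<open>r - \<infinity> = -\<infinity>\<close> for real \<open>r\<close>.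
\<close>

definition subdifferential :: "('a::real_inner \<Rightarrow> ereal) \<Rightarrow> 'a \<Rightarrow> 'a set" where
  "subdifferential F X = {Y. \<forall>Z. F Z - F X \<ge> ereal (inner Y (Z - X))}"

definition minimal_selection :: "('a::real_inner \<Rightarrow> ereal) \<Rightarrow> 'a \<Rightarrow> 'a \<Rightarrow> bool" where
  "minimal_selection F X Y \<longleftrightarrow> is_arg_min norm (\<lambda>Y. Y \<in> subdifferential F X) Y"

lemma convex_subdifferential: "convex (subdifferential F X)"
proof (rule convexI)
  fix Y Y' :: 'a and u v :: real
  assume Y: "Y \<in> subdifferential F X" and Y': "Y' \<in> subdifferential F X"
    and uv: "0 \<le> u" "0 \<le> v" "u + v = 1"
  have "ereal (inner (u *\<^sub>R Y + v *\<^sub>R Y') (Z - X)) \<le> F Z - F X" for Z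
  proof -
    have 1: "ereal (inner Y (Z - X)) \<le> F Z - F X" and 2: "ereal (inner Y' (Z - X)) \<le> F Z - F X"
      using Y Y' by (auto simp: subdifferential_def)
    have "inner (u *\<^sub>R Y + v *\<^sub>R Y') (Z - X) \<le> max (inner Y (Z - X)) (inner Y' (Z - X))"
      unfolding inner_add_left inner_scaleR_left using uv by (intro convex_bound_le) auto
    then have "ereal (inner (u *\<^sub>R Y + v *\<^sub>R Y') (Z - X)) \<le> max (ereal (inner Y (Z - X))) (ereal (inner Y' (Z - X)))"
      by (simp add: max_def split: if_splits)
    also have "\<dots> \<le> F Z - F X" using 1 2 by simp
    finally show ?thesis .
  qed
  then show "u *\<^sub>R Y + v *\<^sub>R Y' \<in> subdifferential F X"
    by (simp add: subdifferential_def)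
qed

text \<open>
  By convexity the relation \<^const>\<open>minimal_selection\<close> determines its last argument, so it may be read
  as: \<open>Y\<close> is the element of minimal norm.
\<close>

lemma minimal_selection_unique:
  assumes "minimal_selection F X Y" "minimal_selection F X Y'"
  shows "Y = Y'"
proof -
  let ?M = "(1/2) *\<^sub>R Y + (1/2) *\<^sub>R Y'"
  have mem: "Y \<in> subdifferential F X" "Y' \<in> subdifferential F X"
    and min: "\<And>Z. Z \<in> subdifferential F X \<Longrightarrow> norm Y \<le> norm Z"
      "\<And>Z. Z \<in> subdifferential F X \<Longrightarrow> norm Y' \<le> norm Z"
    using assms by (auto simp: minimal_selection_def is_arg_min_def not_less)
  have eq: "norm Y = norm Y'" using mem min by (simp add: antisym)
  have "?M \<in> subdifferential F X"
    by (rule convexD[OF convex_subdifferential mem]) auto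
  then have "norm Y \<le> norm ?M" by (rule min)
  then have "inner Y Y \<le> inner ?M ?M"
    by (simp add: norm_le)
  moreover have "inner Y Y = inner Y' Y'"
    using eq by (simp add: norm_eq)
  moreover have "inner ?M ?M = inner Y Y / 4 + inner Y Y' / 2 + inner Y' Y' / 4"
    by (simp add: inner_add_left inner_add_right inner_commute field_simps)
  ultimately have "inner (Y - Y') (Y - Y') \<le> 0"
    by (simp add: inner_diff_left inner_diff_right inner_commute)
  then show ?thesis
    by (metis eq_iff_diff_eq_0 inner_eq_zero_iff inner_ge_zero order_antisym)
qed

definition absolutely_continuous_curve :: "real set \<Rightarrow> (real \<Rightarrow> 'a::metric_space) \<Rightarrow> bool" where
  "absolutely_continuous_curve S X \<longleftrightarrow>
     (\<forall>\<epsilon>>0. \<exists>\<delta>>0. \<forall>d T. d division_of T \<and> T \<subseteq> S \<and> (\<Sum>k\<in>d. Sup k - Inf k) < \<delta> \<longrightarrow>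
        (\<Sum>k\<in>d. dist (X (Sup k)) (X (Inf k))) < \<epsilon>)"

text \<open>
  A curve on \<open>[0,\<infinity>)\<close> is a function on the reals whose values at negative times play no role; as usual
  on an unbounded interval, absolute continuity is required on every compact subinterval.
\<close>

definition gradient_flow :: "('a::real_inner \<Rightarrow> ereal) \<Rightarrow> (real \<Rightarrow> 'a) \<Rightarrow> bool" where
  "gradient_flow F X \<longleftrightarrow>
     (\<forall>T\<ge>0. absolutely_continuous_curve {0..T} X) \<and>
     (AE t in lborel. 0 < t \<longrightarrow>
        (\<exists>D. (X has_vector_derivative D) (at t) \<and> - D \<in> subdifferential F (X t)))"

end

theory Submission
  imports Defs
begin

text \<open>
  The energy has a subgradient at every point of \<open>L\<^sup>2\<close>, because \<open>W_Phi\<close> is convex with derivative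
  \<open>Phi\<close>.  Hence it is convex and lower semicontinuous, its subdifferential constrained to the closed
  convex cone is maximal monotone, and \<open>Xbar\<close> lies in the domain.  Uniqueness is the contraction
  property of monotone operators.

  For existence, the squared distance between two implicit Euler schemes with step sizes \<open>r\<close> and \<open>s\<close>
  satisfies a convexity recursion whose exact solution gives
  \<open>|u\<^sub>n - v\<^sub>m|\<^sup>2 \<le> |w|\<^sup>2 ((n r - m s)\<^sup>2 + n r\<^sup>2 + m s\<^sup>2)\<close>; the limit is a Lipschitz semigroup.  Testing its
  variational inequality with resolvents (Yosida approximations, which converge to the minimal
  section) forces the difference quotients to converge strongly to minus the minimal section wherever the
  norm of the latter is continuous along the flow.  That norm is nonincreasing, so only countably many times are
  lost, without any appeal to the Radon--Nikodym property of \<open>L\<^sup>2\<close>.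
\<close>


section \<open>Flows of maximal monotone operators\<close>

text \<open>The derivative in \<open>gradient_flow\<close> is two-sided, and this is where times get
  lost. A step h to the right of t has length at most h times the minimal norm at t itself; a step
  to the left is only bounded by h times the norm at the earlier time, so the two norms must be
  close. The squared defect |q - p + h a|^2 expands into |p - q|^2 - 2 h <p - q, a> + h^2 |a|^2; an
  upper bound for the length and a lower bound for the inner product force it to be o(h^2), which
  gives strong convergence without weak limits. The same economy is behind the other limits: Yosida
  norms increase and control the differences of the vectors, and minimising sequences are Cauchy by
  the parallelogram law. The energy is finite on all of L^2 because a protocol is at most
  \<open>\<phi> 1\<close> beyond distance 1, so \<open>Phi\<close> grows linearly; a singularity at
  the origin is integrated away. A competitor in the uniqueness claim is only absolutely continuous,
  so the sign of an almost everywhere derivative has to be turned into monotonicity of the squared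
  distance.\<close>

locale maximal_monotone =
  fixes A :: "'a::{real_inner, complete_space} \<Rightarrow> 'a set"
  assumes monotone: "w \<in> A x \<Longrightarrow> v \<in> A y \<Longrightarrow> 0 \<le> inner (w - v) (x - y)"
    and range: "0 < r \<Longrightarrow> \<exists>y. (1 / r) *\<^sub>R (x - y) \<in> A y"
begin

text \<open>The choice is harmless: two solutions y and y' would give -|y - y'|^2 / r >= 0 by
  monotonicity.\<close>

definition resolvent :: "real \<Rightarrow> 'a \<Rightarrow> 'a" where
  "resolvent r x = (SOME y. (1 / r) *\<^sub>R (x - y) \<in> A y)"

definition yosida :: "real \<Rightarrow> 'a \<Rightarrow> 'a" where
  "yosida r x = (1 / r) *\<^sub>R (x - resolvent r x)"

lemma yosida_mem: "0 < r \<Longrightarrow> yosida r x \<in> A (resolvent r x)"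
  unfolding yosida_def resolvent_def by (rule someI_ex[OF range])

lemma diff_resolvent: "0 < r \<Longrightarrow> x - resolvent r x = r *\<^sub>R yosida r x"
  by (simp add: yosida_def)

lemma resolvent_eq: "0 < r \<Longrightarrow> resolvent r x = x - r *\<^sub>R yosida r x"
  by (simp add: yosida_def)

text \<open>Minty's argument: solvability at step 1 with datum \<open>x + w\<close> produces y with
  \<open>x + w - y\<close> in \<open>A y\<close>. Testing the assumption with this pair gives -|x -
  y|^2 >= 0, so y = x and the element of \<open>A y\<close> is \<open>w\<close>.\<close>

lemma maximal:
  assumes "\<And>y v. v \<in> A y \<Longrightarrow> 0 \<le> inner (w - v) (x - y)"
  shows "w \<in> A x"
proof -
  obtain y where y: "(x + w) - y \<in> A y"
    using range[of 1 "x + w"] by auto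
  have "inner (w - ((x + w) - y)) (x - y) = - inner (x - y) (x - y)"
    by (simp add: inner_diff_left inner_diff_right inner_add_left)
  with assms[OF y] have "inner (x - y) (x - y) \<le> 0" by simp
  then have "x = y"
    by (metis eq_iff_diff_eq_0 inner_eq_zero_iff inner_ge_zero order_antisym)
  with y show ?thesis by simp
qed

text \<open>Monotonicity at the two resolvent points says that their difference d satisfies |d|^2 <=
  <x - y, d>; Cauchy-Schwarz cancels one factor |d|.\<close>

lemma resolvent_nonexpansive:
  assumes "0 < r"
  shows "norm (resolvent r x - resolvent r y) \<le> norm (x - y)"
proof -
  let ?d = "resolvent r x - resolvent r y"
  have "0 \<le> r * inner (yosida r x - yosida r y) ?d"
    using monotone[OF yosida_mem[OF assms] yosida_mem[OF assms]] assms by simp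
  also have "\<dots> = inner (r *\<^sub>R yosida r x - r *\<^sub>R yosida r y) ?d"
    by (simp add: inner_diff_left right_diff_distrib)
  also have "\<dots> = inner (x - y) ?d - inner ?d ?d"
    by (simp only: diff_resolvent[OF assms, symmetric]) (simp add: inner_diff_left)
  finally have "norm ?d * norm ?d \<le> norm (x - y) * norm ?d"
    using norm_cauchy_schwarz[of "x - y" ?d] by (simp add: power2_norm_eq_inner[symmetric] power2_eq_square)
  then show ?thesis
    by (metis mult_right_le_imp_le norm_ge_zero norm_le_zero_iff order_le_less linorder_not_le order_trans)
qed

text \<open>Monotonicity is tested between \<open>w\<close> at \<open>x\<close> and the Yosida
  element at the resolvent; the two base points differ by a multiple of that element itself.\<close>

lemma yosida_le:
  assumes "0 < r" "w \<in> A x"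
  shows "norm (yosida r x) \<le> norm w"
proof -
  have "0 \<le> inner (w - yosida r x) (r *\<^sub>R yosida r x)"
    using monotone[OF assms(2) yosida_mem[OF assms(1)]] diff_resolvent[OF assms(1)] by metis
  then have "inner (yosida r x) (yosida r x) \<le> inner w (yosida r x)"
    using assms by (simp add: inner_diff_left zero_le_mult_iff)
  also have "\<dots> \<le> norm w * norm (yosida r x)" by (rule norm_cauchy_schwarz)
  finally have "norm (yosida r x) * norm (yosida r x) \<le> norm w * norm (yosida r x)"
    by (simp add: power2_norm_eq_inner[symmetric] power2_eq_square)
  then show ?thesis
    by (metis mult_right_le_imp_le norm_ge_zero norm_le_zero_iff order_le_less linorder_not_le order_trans)
qed

text \<open>The two resolvents differ by s A_s x - r A_r x, so monotonicity yields <A_s x - A_r x,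
  A_r x> >= 0. The norms thus grow as the step shrinks, and in this Pythagorean form their growth
  controls the distance of the vectors.\<close>

lemma yosida_antimono:
  assumes "0 < s" "s \<le> r"
  shows "(norm (yosida s x - yosida r x))\<^sup>2 \<le> (norm (yosida s x))\<^sup>2 - (norm (yosida r x))\<^sup>2"
proof -
  let ?a = "yosida r x" and ?b = "yosida s x"
  have r: "0 < r" using assms by simp
  have "0 \<le> inner (?a - ?b) (resolvent r x - resolvent s x)"
    by (intro monotone yosida_mem assms r)
  also have "\<dots> = - (s * inner (?a - ?b) (?a - ?b)) - (r - s) * inner (?a - ?b) ?a"
    by (simp add: resolvent_eq[OF assms(1)] resolvent_eq[OF r] inner_diff_left inner_diff_right algebra_simps inner_commute)
  finally have "(r - s) * inner (?a - ?b) ?a \<le> - (s * inner (?a - ?b) (?a - ?b))" by simp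
  also have "\<dots> \<le> 0" using assms by simp
  finally have "inner (?a - ?b) ?a \<le> 0 \<or> r = s"
    using assms by (auto simp: mult_le_0_iff)
  moreover have "inner (?a - ?b) ?a \<le> 0" if "r = s"
    using that by simp
  ultimately have "inner ?a ?a \<le> inner ?b ?a" by (auto simp: inner_diff_left)
  then show ?thesis
    by (simp add: power2_norm_eq_inner inner_diff_left inner_diff_right inner_commute)
qed

text \<open>Domain criterion: the norms increase and are bounded, so they converge, and
  \<open>yosida_antimono\<close> makes the vectors Cauchy. The limit lies in \<open>A x\<close> by
  maximality because the resolvents tend to \<open>x\<close>. A uniform bound on Yosida norms
  survives limits in \<open>x\<close>, hence so does membership in the domain.\<close>

lemma yosida_bounded_imp_limit:
  assumes bd: "\<And>r. 0 < r \<Longrightarrow> norm (yosida r x) \<le> C"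
  obtains w where "w \<in> A x" "norm w \<le> C"
    "(\<lambda>n. yosida (1 / real (Suc n)) x) \<longlonglongrightarrow> w"
proof -
  define r where "r n = 1 / real (Suc n)" for n
  define a where "a n = yosida (r n) x" for n
  have r0: "0 < r n" for n by (simp add: r_def)
  have rmono: "r n \<le> r m" if "m \<le> n" for m n
    using that by (simp add: r_def frac_le)
  have rlim: "r \<longlonglongrightarrow> 0"
    unfolding r_def using LIMSEQ_inverse_real_of_nat by (simp add: inverse_eq_divide)
  have sq: "(norm (a n - a m))\<^sup>2 \<le> (norm (a n))\<^sup>2 - (norm (a m))\<^sup>2" if "m \<le> n" for m n
    unfolding a_def by (rule yosida_antimono[OF r0 rmono[OF that]])
  have aC: "norm (a n) \<le> C" for n using bd r0 by (simp add: a_def)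
  have inc: "incseq (\<lambda>n. (norm (a n))\<^sup>2)"
    unfolding incseq_def by (metis sq diff_ge_0_iff_ge order_trans zero_le_power2)
  have "bdd_above (range (\<lambda>n. (norm (a n))\<^sup>2))"
    by (rule bdd_aboveI2[of _ _ "C\<^sup>2"]) (intro power_mono aC norm_ge_zero)
  with inc have cv: "Cauchy (\<lambda>n. (norm (a n))\<^sup>2)"
    by (intro LIMSEQ_imp_Cauchy) (rule LIMSEQ_incseq_SUP)
  have "Cauchy a"
  proof (rule CauchyI)
    fix e :: real assume e: "0 < e"
    then obtain M where M: "\<And>m n. M \<le> m \<Longrightarrow> M \<le> n \<Longrightarrow> norm ((norm (a m))\<^sup>2 - (norm (a n))\<^sup>2) < e\<^sup>2"
      using CauchyD[OF cv, of "e\<^sup>2"] by (metis zero_less_power)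
    have "norm (a m - a n) < e" if mn: "M \<le> m" "M \<le> n" for m n
    proof -
      have "(norm (a m - a n))\<^sup>2 \<le> \<bar>(norm (a m))\<^sup>2 - (norm (a n))\<^sup>2\<bar>"
        using sq[of m n] sq[of n m] by (cases "m \<le> n") (auto simp: norm_minus_commute)
      also have "\<dots> < e\<^sup>2" using M[OF mn] by simp
      finally show ?thesis using e by (simp add: power2_less_imp_less)
    qed
    then show "\<exists>M. \<forall>m\<ge>M. \<forall>n\<ge>M. norm (a m - a n) < e" by blast
  qed
  then obtain w where w: "a \<longlonglongrightarrow> w"
    using Cauchy_convergent_iff convergent_def by blast
  have J: "(\<lambda>n. resolvent (r n) x) \<longlonglongrightarrow> x"
  proof -
    have "(\<lambda>n. x - r n *\<^sub>R a n) \<longlonglongrightarrow> x - 0 *\<^sub>R w"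
      by (intro tendsto_intros rlim w)
    then show ?thesis by (simp add: a_def resolvent_eq[OF r0])
  qed
  have "w \<in> A x"
  proof (rule maximal)
    fix y v assume v: "v \<in> A y"
    have "(\<lambda>n. inner (a n - v) (resolvent (r n) x - y)) \<longlonglongrightarrow> inner (w - v) (x - y)"
      by (intro tendsto_intros w J)
    then show "0 \<le> inner (w - v) (x - y)"
      by (rule tendsto_lowerbound)
        (auto intro!: always_eventually monotone v yosida_mem r0 simp: a_def)
  qed
  moreover have "norm w \<le> C"
    by (rule tendsto_upperbound[OF tendsto_norm[OF w]]) (auto simp: aC)
  ultimately show ?thesis using w that unfolding a_def r_def by blast
qed

text \<open>On the domain of \<open>A\<close> this is the element of least norm: every Yosida norm
  is below the norm of each element of \<open>A x\<close>, and the limit belongs to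
  \<open>A x\<close>. Off the domain the value carries no meaning.\<close>

definition min_section :: "'a \<Rightarrow> 'a" where
  "min_section x = lim (\<lambda>n. yosida (1 / real (Suc n)) x)"

lemma
  assumes "w \<in> A x"
  shows min_section_mem: "min_section x \<in> A x"
    and min_section_le: "norm (min_section x) \<le> norm w"
    and yosida_tendsto: "(\<lambda>n. yosida (1 / real (Suc n)) x) \<longlonglongrightarrow> min_section x"
proof -
  obtain a where "a \<in> A x" "norm a \<le> norm w"
    and a: "(\<lambda>n. yosida (1 / real (Suc n)) x) \<longlonglongrightarrow> a"
    using yosida_bounded_imp_limit[of x "norm w"] yosida_le[OF _ assms] by metis
  moreover have "min_section x = a" unfolding min_section_def by (rule limI[OF a])
  ultimately show "min_section x \<in> A x" "norm (min_section x) \<le> norm w"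
    "(\<lambda>n. yosida (1 / real (Suc n)) x) \<longlonglongrightarrow> min_section x" by auto
qed

section \<open>Implicit Euler iterates and their a priori estimates\<close>

abbreviation euler :: "real \<Rightarrow> nat \<Rightarrow> 'a \<Rightarrow> 'a" where
  "euler r n x \<equiv> (resolvent r ^^ n) x"

lemma euler_nonexpansive: "0 < r \<Longrightarrow> norm (euler r n x - euler r n y) \<le> norm (x - y)"
  by (induction n) (auto intro: order_trans[OF resolvent_nonexpansive])

text \<open>Both iterates are n steps, one from \<open>resolvent r x\<close> and one from
  \<open>x\<close>; nonexpansiveness reduces every increment to the first one, which is
  \<open>r\<close> times a Yosida norm.\<close>

lemma euler_step:
  assumes "0 < r" "w \<in> A x"
  shows "norm (euler r (Suc n) x - euler r n x) \<le> r * norm w"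
proof -
  have "norm (euler r (Suc n) x - euler r n x) = norm (euler r n (resolvent r x) - euler r n x)"
    by (simp add: funpow_swap1)
  also have "\<dots> \<le> norm (resolvent r x - x)" by (rule euler_nonexpansive[OF assms(1)])
  also have "\<dots> = r * norm (yosida r x)"
    using assms by (simp add: resolvent_eq)
  also have "\<dots> \<le> r * norm w"
    using yosida_le[OF assms] assms(1) by simp
  finally show ?thesis .
qed

text \<open>After at least one step an iterate carries the Yosida element of its predecessor, whose
  norm is the last increment divided by \<open>r\<close>.\<close>

lemma euler_mem:
  assumes "0 < r" "w \<in> A x"
  obtains v where "v \<in> A (euler r n x)" "norm v \<le> norm w"
proof (cases n)
  case 0
  then show ?thesis using that assms by auto
next
  case (Suc m)
  have "r * norm (yosida r (euler r m x)) = norm (euler r (Suc m) x - euler r m x)"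
    using assms by (simp add: resolvent_eq)
  also have "\<dots> \<le> r * norm w" by (rule euler_step[OF assms])
  finally have "norm (yosida r (euler r m x)) \<le> norm w" using assms by simp
  moreover have "yosida r (euler r m x) \<in> A (euler r n x)"
    using yosida_mem[OF assms(1)] Suc by simp
  ultimately show ?thesis using that by blast
qed

lemma euler_dist_start:
  assumes "0 < r" "w \<in> A x"
  shows "norm (euler r n x - x) \<le> real n * r * norm w"
proof (induction n)
  case (Suc n)
  have "norm (euler r (Suc n) x - x) \<le> norm (euler r (Suc n) x - euler r n x) + norm (euler r n x - x)"
    by (metis norm_triangle_ineq diff_add_cancel add_diff_eq)
  also have "\<dots> \<le> r * norm w + real n * r * norm w"
    by (intro add_mono euler_step assms Suc)
  finally show ?case by (simp add: algebra_simps)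
qed simp

text \<open>The bracket E satisfies (r + s) E(n+1,m+1) = s E(n,m+1) + r E(n+1,m) exactly: with
  weights s and r the cross terms of the shifted squares cancel, and the surplus s r^2 + r s^2 is
  what the two linear terms lose. On the axes E dominates the bound from
  \<open>euler_dist_start\<close>.\<close>

lemma euler_dist:
  assumes r: "0 < r" and s: "0 < s" and w: "w \<in> A x"
  shows "(norm (euler r n x - euler s m x))\<^sup>2
    \<le> (norm w)\<^sup>2 * ((real n * r - real m * s)\<^sup>2 + real n * r\<^sup>2 + real m * s\<^sup>2)"
proof (induction n arbitrary: m)
  case 0
  have "(norm (x - euler s m x))\<^sup>2 \<le> (real m * s * norm w)\<^sup>2"
    using euler_dist_start[OF s w, of m] by (intro power_mono) (auto simp: norm_minus_commute)
  also have "\<dots> \<le> (norm w)\<^sup>2 * ((real m * s)\<^sup>2 + real m * s\<^sup>2)"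
    by (simp add: power_mult_distrib mult.commute mult_left_mono)
  finally show ?case by simp
next
  case (Suc n)
  note IHn = this
  show ?case
  proof (induction m)
    case 0
    have "(norm (euler r (Suc n) x - x))\<^sup>2 \<le> (real (Suc n) * r * norm w)\<^sup>2"
      using euler_dist_start[OF r w, of "Suc n"] by (intro power_mono) auto
    also have "\<dots> \<le> (norm w)\<^sup>2 * ((real (Suc n) * r)\<^sup>2 + real (Suc n) * r\<^sup>2)"
      by (simp add: power_mult_distrib mult.commute mult_left_mono del: of_nat_Suc)
    finally show ?case by simp
  next
    case (Suc m)
    let ?p = "euler r n x" and ?q = "euler s m x"
    let ?u = "euler r (Suc n) x" and ?v = "euler s (Suc m) x"
    let ?E = "\<lambda>n m. (real n * r - real m * s)\<^sup>2 + real n * r\<^sup>2 + real m * s\<^sup>2"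
    \<comment> \<open>The factor r s turns both Yosida elements into increments. The mixed products
      are then bounded by 2 <a, b> <= |a|^2 + |b|^2, and half of (r + s) |u - v|^2 is absorbed on
      the left.\<close>
    have "0 \<le> r * s * inner (yosida r ?p - yosida s ?q) (?u - ?v)"
      using monotone[OF yosida_mem[OF r, of ?p] yosida_mem[OF s, of ?q]] r s by simp
    also have "\<dots> = inner (s *\<^sub>R (r *\<^sub>R yosida r ?p) - r *\<^sub>R (s *\<^sub>R yosida s ?q)) (?u - ?v)"
      by (simp add: inner_diff_left algebra_simps)
    also have "\<dots> = inner (s *\<^sub>R (?p - ?u) - r *\<^sub>R (?q - ?v)) (?u - ?v)"
      using r s by (simp add: diff_resolvent)
    also have "\<dots> = s * inner (?p - ?v) (?u - ?v) + r * inner (?u - ?q) (?u - ?v)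
        - (r + s) * (norm (?u - ?v))\<^sup>2"
      unfolding power2_norm_eq_inner
      by (simp add: inner_diff_left inner_diff_right inner_commute algebra_simps)
    finally have 1: "(r + s) * (norm (?u - ?v))\<^sup>2
        \<le> s * inner (?p - ?v) (?u - ?v) + r * inner (?u - ?q) (?u - ?v)" by simp
    have half: "2 * inner a b \<le> (norm a)\<^sup>2 + (norm b)\<^sup>2" for a b :: 'a
    proof -
      have "0 \<le> inner (a - b) (a - b)" by simp
      then show ?thesis
        by (simp add: power2_norm_eq_inner inner_diff_left inner_diff_right inner_commute)
    qed
    have "s * (2 * inner (?p - ?v) (?u - ?v)) \<le> s * ((norm (?p - ?v))\<^sup>2 + (norm (?u - ?v))\<^sup>2)"
      "r * (2 * inner (?u - ?q) (?u - ?v)) \<le> r * ((norm (?u - ?q))\<^sup>2 + (norm (?u - ?v))\<^sup>2)"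
      using r s by (intro mult_left_mono half; simp)+
    with 1 have "(r + s) * (norm (?u - ?v))\<^sup>2 \<le> s * (norm (?p - ?v))\<^sup>2 + r * (norm (?u - ?q))\<^sup>2"
      by (simp add: algebra_simps)
    also have "\<dots> \<le> s * ((norm w)\<^sup>2 * ?E n (Suc m)) + r * ((norm w)\<^sup>2 * ?E (Suc n) m)"
      using r s by (intro add_mono mult_left_mono IHn Suc.IH) auto
    also have "\<dots> = (r + s) * ((norm w)\<^sup>2 * ?E (Suc n) (Suc m))"
      by (simp add: algebra_simps power2_eq_square)
    finally show ?case using r s by simp
  qed
qed

section \<open>The semigroup as a limit of Euler schemes\<close>

definition flow :: "real \<Rightarrow> 'a \<Rightarrow> 'a" where
  "flow t x = lim (\<lambda>k. euler (1 / real (Suc k)) (nat \<lfloor>t * real (Suc k)\<rfloor>) x)"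

lemma step_count:
  assumes "0 \<le> t"
  defines "n k \<equiv> real (nat \<lfloor>t * real (Suc k)\<rfloor>) * (1 / real (Suc k))"
  shows "n k \<le> t" "t \<le> n k + 1 / real (Suc k)"
proof -
  let ?f = "\<lfloor>t * real (Suc k)\<rfloor>"
  have f: "real (nat ?f) = real_of_int ?f" using assms by simp
  have "real_of_int ?f \<le> t * real (Suc k)" "t * real (Suc k) \<le> real_of_int ?f + 1" by linarith+
  then show "n k \<le> t" "t \<le> n k + 1 / real (Suc k)"
    unfolding n_def f by (simp_all add: field_simps)
qed

lemma step_count_tendsto:
  assumes "0 \<le> t"
  shows "(\<lambda>k. real (nat \<lfloor>t * real (Suc k)\<rfloor>) * (1 / real (Suc k))) \<longlonglongrightarrow> t"
proof (rule tendsto_sandwich)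
  have "(\<lambda>k. t - inverse (real (Suc k))) \<longlonglongrightarrow> t - 0"
    by (intro tendsto_intros LIMSEQ_inverse_real_of_nat)
  then show "(\<lambda>k. t - 1 / real (Suc k)) \<longlonglongrightarrow> t" by (simp add: inverse_eq_divide)
  show "\<forall>\<^sub>F k in sequentially. t - 1 / real (Suc k) \<le> real (nat \<lfloor>t * real (Suc k)\<rfloor>) * (1 / real (Suc k))"
    using step_count(2)[OF assms] by (simp add: algebra_simps)
  show "\<forall>\<^sub>F k in sequentially. real (nat \<lfloor>t * real (Suc k)\<rfloor>) * (1 / real (Suc k)) \<le> t"
    using step_count(1)[OF assms] by simp
qed simp

lemma flow_tendsto:
  assumes w: "w \<in> A x" and t: "0 \<le> t"
  shows "(\<lambda>k. euler (1 / real (Suc k)) (nat \<lfloor>t * real (Suc k)\<rfloor>) x) \<longlonglongrightarrow> flow t x"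
proof -
  define r where "r k = 1 / real (Suc k)" for k
  define n where "n k = nat \<lfloor>t * real (Suc k)\<rfloor>" for k
  define u where "u k = euler (r k) (n k) x" for k
  have r0: "0 < r k" for k by (simp add: r_def)
  have nr: "real (n k) * r k \<le> t" "t \<le> real (n k) * r k + r k" for k
    using step_count[OF t, of k] by (simp_all add: n_def r_def)
  \<comment> \<open>\<open>L\<close> is divided by below, while \<open>norm w\<close> may
    vanish.\<close>
  define L where "L = 1 + norm w"
  have L: "0 < L" by (simp add: L_def add_pos_nonneg)
  \<comment> \<open>Step count times step size lies within one step of \<open>t\<close> in both
    schemes, so these times differ by at most r k + r l; the square of this sum is at most twice it
    because steps do not exceed 1. The linear terms are bounded by n r^2 <= t r.\<close>
  have bound: "(norm (u k - u l))\<^sup>2 \<le> L\<^sup>2 * ((r k + r l) * (2 + t))" for k l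
  proof -
    have "\<bar>real (n k) * r k - real (n l) * r l\<bar> \<le> r k + r l"
      using nr[of k] nr[of l] r0[of k] r0[of l] by linarith
    then have "(real (n k) * r k - real (n l) * r l)\<^sup>2 \<le> (r k + r l)\<^sup>2"
      by (metis abs_ge_zero power2_abs power_mono)
    also have "\<dots> \<le> (r k + r l) * 2"
    proof -
      have "r k \<le> 1" "r l \<le> 1" by (simp_all add: r_def)
      then show ?thesis
        unfolding power2_eq_square using r0[of k] r0[of l] by (intro mult_left_mono) auto
    qed
    moreover have "real (n j) * (r j)\<^sup>2 \<le> t * r j" for j
      using mult_right_mono[OF nr(1)[of j], of "r j"] r0[of j] by (simp add: power2_eq_square mult.assoc)
    ultimately have "(real (n k) * r k - real (n l) * r l)\<^sup>2 + real (n k) * (r k)\<^sup>2 + real (n l) * (r l)\<^sup>2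
        \<le> (r k + r l) * 2 + t * r k + t * r l" by (meson add_mono order_trans)
    also have "\<dots> = (r k + r l) * (2 + t)" by (simp add: algebra_simps)
    finally have "(norm w)\<^sup>2 * ((real (n k) * r k - real (n l) * r l)\<^sup>2 + real (n k) * (r k)\<^sup>2 + real (n l) * (r l)\<^sup>2)
      \<le> L\<^sup>2 * ((r k + r l) * (2 + t))"
      by (intro mult_mono power_mono) (auto simp: L_def)
    with euler_dist[OF r0[of k] r0[of l] w, of "n k" "n l"] show ?thesis
      unfolding u_def by linarith
  qed
  have rlim: "r \<longlonglongrightarrow> 0"
    unfolding r_def using LIMSEQ_inverse_real_of_nat by (simp add: inverse_eq_divide)
  have "Cauchy u"
  proof (rule CauchyI)
    fix e :: real assume e: "0 < e"
    define d where "d = e\<^sup>2 / (2 * L\<^sup>2 * (2 + t))"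
    have d: "0 < d" using e L t by (simp add: d_def)
    then obtain M where M: "\<And>k. M \<le> k \<Longrightarrow> r k < d"
      using LIMSEQ_D[OF rlim, of d] by (auto simp: abs_less_iff)
    have "norm (u k - u l) < e" if kl: "M \<le> k" "M \<le> l" for k l
    proof -
      have "(norm (u k - u l))\<^sup>2 \<le> L\<^sup>2 * ((r k + r l) * (2 + t))" by (rule bound)
      also have "\<dots> < L\<^sup>2 * ((d + d) * (2 + t))"
        using M[OF kl(1)] M[OF kl(2)] L t by (intro mult_strict_left_mono mult_strict_right_mono add_strict_mono) auto
      also have "\<dots> = (2 * L\<^sup>2 * (2 + t)) * d" by simp
      also have "\<dots> = e\<^sup>2" using L t by (simp add: d_def del: distrib_left_numeral)
      finally show ?thesis using e by (simp add: power2_less_imp_less)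
    qed
    then show "\<exists>M. \<forall>m\<ge>M. \<forall>n\<ge>M. norm (u m - u n) < e" by blast
  qed
  then have "convergent u" by (simp add: Cauchy_convergent)
  then show ?thesis
    unfolding flow_def by (simp add: u_def[abs_def] r_def n_def convergent_LIMSEQ_iff)
qed

lemma flow_0 [simp]: "flow 0 x = x"
  by (simp add: flow_def)

text \<open>With equal step sizes in both schemes the linear terms of \<open>euler_dist\<close> tend
  to 0 and only (t - s)^2 survives.\<close>

lemma flow_lipschitz:
  assumes w: "w \<in> A x" and t: "0 \<le> t" and s: "0 \<le> s"
  shows "norm (flow t x - flow s x) \<le> norm w * \<bar>t - s\<bar>"
proof -
  define r where "r k = 1 / real (Suc k)" for k
  define n where "n t k = nat \<lfloor>t * real (Suc k)\<rfloor>" for t k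
  have r0: "0 < r k" for k by (simp add: r_def)
  have rlim: "r \<longlonglongrightarrow> 0"
    unfolding r_def using LIMSEQ_inverse_real_of_nat by (simp add: inverse_eq_divide)
  note lims = flow_tendsto[OF w t, folded r_def n_def] flow_tendsto[OF w s, folded r_def n_def]
    step_count_tendsto[OF t, folded r_def n_def] step_count_tendsto[OF s, folded r_def n_def] rlim
  have "(norm (flow t x - flow s x))\<^sup>2 \<le> (norm w)\<^sup>2 * ((t - s)\<^sup>2 + t * 0 + s * 0)"
  proof (rule LIMSEQ_le)
    show "(\<lambda>k. (norm (euler (r k) (n t k) x - euler (r k) (n s k) x))\<^sup>2) \<longlonglongrightarrow> (norm (flow t x - flow s x))\<^sup>2"
      by (intro tendsto_intros lims)
    show "(\<lambda>k. (norm w)\<^sup>2 * ((real (n t k) * r k - real (n s k) * r k)\<^sup>2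
        + real (n t k) * r k * r k + real (n s k) * r k * r k)) \<longlonglongrightarrow> (norm w)\<^sup>2 * ((t - s)\<^sup>2 + t * 0 + s * 0)"
      by (intro tendsto_intros lims)
    show "\<exists>N. \<forall>k\<ge>N. (norm (euler (r k) (n t k) x - euler (r k) (n s k) x))\<^sup>2
      \<le> (norm w)\<^sup>2 * ((real (n t k) * r k - real (n s k) * r k)\<^sup>2 + real (n t k) * r k * r k + real (n s k) * r k * r k)"
      using euler_dist[OF r0 r0 w] by (simp add: power2_eq_square mult.assoc)
  qed
  also have "\<dots> = (norm w * \<bar>t - s\<bar>)\<^sup>2" by (simp add: power_mult_distrib)
  finally show ?thesis by (rule power2_le_imp_le) simp
qed

text \<open>For a fixed step the Yosida map is continuous, and along the Euler iterates it is
  bounded by \<open>norm w\<close>; the bound passes to the limit point, where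
  \<open>yosida_bounded_imp_limit\<close> applies.\<close>

lemma flow_mem:
  assumes w: "w \<in> A x" and t: "0 \<le> t"
  shows "min_section (flow t x) \<in> A (flow t x)" "norm (min_section (flow t x)) \<le> norm w"
proof -
  have "norm (yosida s (flow t x)) \<le> norm w" if s: "0 < s" for s
  proof -
    let ?u = "\<lambda>k. euler (1 / real (Suc k)) (nat \<lfloor>t * real (Suc k)\<rfloor>) x"
    have u: "?u \<longlonglongrightarrow> flow t x" by (rule flow_tendsto[OF w t])
    have "(\<lambda>k. resolvent s (?u k)) \<longlonglongrightarrow> resolvent s (flow t x)"
    proof (rule LIM_zero_cancel, rule Lim_null_comparison)
      show "\<forall>\<^sub>F k in sequentially. norm (resolvent s (?u k) - resolvent s (flow t x)) \<le> norm (?u k - flow t x)"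
        by (simp add: resolvent_nonexpansive[OF s])
      show "(\<lambda>k. norm (?u k - flow t x)) \<longlonglongrightarrow> 0"
        using u by (simp add: LIM_zero tendsto_norm_zero)
    qed
    then have "(\<lambda>k. yosida s (?u k)) \<longlonglongrightarrow> yosida s (flow t x)"
      unfolding yosida_def by (intro tendsto_intros u)
    moreover have "norm (yosida s (?u k)) \<le> norm w" for k
      by (rule euler_mem[OF _ w, of "1 / real (Suc k)" "nat \<lfloor>t * real (Suc k)\<rfloor>"])
        (auto intro: order_trans[OF yosida_le[OF s]])
    ultimately show ?thesis
      by (intro tendsto_upperbound[OF tendsto_norm]) auto
  qed
  then obtain v where v: "v \<in> A (flow t x)" "norm v \<le> norm w"
    using yosida_bounded_imp_limit[of "flow t x" "norm w"] by blast
  show "min_section (flow t x) \<in> A (flow t x)" "norm (min_section (flow t x)) \<le> norm w"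
    using min_section_mem[OF v(1)] order_trans[OF min_section_le[OF v(1)] v(2)] by auto
qed

text \<open>The rounded step count for s + t is the sum of the two rounded counts or one more. The
  extra step costs at most \<open>r k * norm w\<close>, and nonexpansiveness keeps the error of the
  intermediate starting point from growing.\<close>

lemma flow_add:
  assumes w: "w \<in> A x" and s: "0 \<le> s" and t: "0 \<le> t"
  shows "flow (s + t) x = flow t (flow s x)"
proof -
  define r where "r k = 1 / real (Suc k)" for k
  define n where "n t k = nat \<lfloor>t * real (Suc k)\<rfloor>" for t k
  have r0: "0 < r k" for k by (simp add: r_def)
  have st: "0 \<le> s + t" using s t by simp
  have rlim: "r \<longlonglongrightarrow> 0"
    unfolding r_def using LIMSEQ_inverse_real_of_nat by (simp add: inverse_eq_divide)
  let ?y = "flow s x"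
  have n: "n (s + t) k = n t k + n s k \<or> n (s + t) k = Suc (n t k + n s k)" for k
  proof -
    have "0 \<le> s * real (Suc k)" "0 \<le> t * real (Suc k)" using s t by auto
    then show ?thesis unfolding n_def distrib_right by linarith
  qed
  have "(\<lambda>k. euler (r k) (n (s + t) k) x - euler (r k) (n t k) ?y) \<longlonglongrightarrow> 0"
  proof (rule Lim_null_comparison)
    show "(\<lambda>k. r k * norm w + norm (euler (r k) (n s k) x - ?y)) \<longlonglongrightarrow> 0"
      using tendsto_add[OF tendsto_mult_left_zero[OF rlim, of "norm w"]
         tendsto_norm_zero[OF LIM_zero[OF flow_tendsto[OF w s]]]]
      by (simp add: n_def r_def)
    have "norm (euler (r k) (n (s + t) k) x - euler (r k) (n t k) ?y) \<le> r k * norm w + norm (euler (r k) (n s k) x - ?y)" for k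
    proof -
      have 1: "norm (euler (r k) (n (s + t) k) x - euler (r k) (n t k + n s k) x) \<le> r k * norm w"
        using n[of k] euler_step[OF r0[of k] w, of "n t k + n s k"] r0[of k] by auto
      have "norm (euler (r k) (n t k + n s k) x - euler (r k) (n t k) ?y)
         = norm (euler (r k) (n t k) (euler (r k) (n s k) x) - euler (r k) (n t k) ?y)"
        by (simp add: funpow_add)
      also have "\<dots> \<le> norm (euler (r k) (n s k) x - ?y)" by (rule euler_nonexpansive[OF r0])
      finally show ?thesis
        using 1 norm_triangle_ineq[of "euler (r k) (n (s + t) k) x - euler (r k) (n t k + n s k) x"
            "euler (r k) (n t k + n s k) x - euler (r k) (n t k) ?y"] by simp
    qed
    then show "\<forall>\<^sub>F k in sequentially. norm (euler (r k) (n (s + t) k) x - euler (r k) (n t k) ?y)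
       \<le> r k * norm w + norm (euler (r k) (n s k) x - ?y)" by simp
  qed
  moreover have "(\<lambda>k. euler (r k) (n (s + t) k) x - euler (r k) (n t k) ?y) \<longlonglongrightarrow> flow (s + t) x - flow t ?y"
    using flow_tendsto[OF w st] flow_tendsto[OF flow_mem(1)[OF w s] t]
    by (intro tendsto_diff) (simp_all add: n_def r_def)
  ultimately have "flow (s + t) x - flow t ?y = 0" by (rule LIMSEQ_unique[rotated])
  then show ?thesis by simp
qed

section \<open>Variational inequality and derivative of the semigroup\<close>

lemma flow_evi:
  assumes w: "w \<in> A x" and v: "v \<in> A y" and t: "0 \<le> t"
  shows "(norm (flow t x - y))\<^sup>2 - (norm (x - y))\<^sup>2
    \<le> 2 * t * (inner v (y - x) + norm v * norm w * t)"
proof -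
  define r where "r k = 1 / real (Suc k)" for k
  define n where "n t k = nat \<lfloor>t * real (Suc k)\<rfloor>" for t k
  have r0: "0 < r k" for k by (simp add: r_def)
  \<comment> \<open>One step changes the squared distance to \<open>y\<close> by at most 2 h <v, y -
    u>, where u is the new iterate. Replacing u by \<open>x\<close> costs the distance travelled;
    bounding it by the fixed horizon \<open>N\<close> instead of m makes all summands equal, so the
    induction merely adds them.\<close>
  have step: "(norm (euler h m x - y))\<^sup>2 - (norm (x - y))\<^sup>2
      \<le> 2 * (real m * h) * (inner v (y - x) + norm v * norm w * (real N * h))"
    if h: "0 < h" and "m \<le> N" for h m N
    using \<open>m \<le> N\<close>
  proof (induction m)
    case (Suc m)
    let ?p = "euler h m x" and ?u = "euler h (Suc m) x"
    have "0 \<le> h * inner (yosida h ?p - v) (?u - y)"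
      using monotone[OF yosida_mem[OF h, of ?p] v] h by simp
    also have "\<dots> = inner (h *\<^sub>R yosida h ?p) (?u - y) - h * inner v (?u - y)"
      by (simp add: inner_diff_left algebra_simps)
    also have "h *\<^sub>R yosida h ?p = ?p - ?u" using h by (simp add: diff_resolvent)
    finally have 1: "inner (?u - ?p) (?u - y) \<le> h * inner v (y - ?u)"
      by (simp add: inner_diff_left inner_diff_right algebra_simps)
    have "(norm (?u - y))\<^sup>2 - (norm (?p - y))\<^sup>2 = 2 * inner (?u - ?p) (?u - y) - (norm (?u - ?p))\<^sup>2"
      by (simp add: power2_norm_eq_inner inner_diff_left inner_diff_right inner_commute)
    also have "\<dots> \<le> 2 * (h * inner v (y - ?u))" using 1 by (smt (verit) zero_le_power2)
    also have "inner v (y - ?u) = inner v (y - x) + inner v (x - ?u)" by (simp add: inner_diff_right)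
    also have "inner v (x - ?u) \<le> norm v * norm w * (real N * h)"
    proof -
      have "norm (x - ?u) \<le> real (Suc m) * h * norm w"
        using euler_dist_start[OF h w, of "Suc m"] by (simp add: norm_minus_commute)
      also have "\<dots> \<le> real N * h * norm w"
        using Suc.prems h by (intro mult_right_mono) auto
      finally have "norm (x - ?u) \<le> real N * h * norm w" .
      then have "norm v * norm (x - ?u) \<le> norm v * (real N * h * norm w)" by (intro mult_left_mono) auto
      with norm_cauchy_schwarz[of v "x - ?u"] show ?thesis by (simp only: mult_ac)
    qed
    finally have "(norm (?u - y))\<^sup>2 - (norm (?p - y))\<^sup>2
        \<le> 2 * (h * (inner v (y - x) + norm v * norm w * (real N * h)))"
      using h by (simp add: mult_left_mono)
    with Suc show ?case by (simp add: algebra_simps)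
  qed simp
  show ?thesis
  proof (rule LIMSEQ_le)
    show "(\<lambda>k. (norm (euler (r k) (n t k) x - y))\<^sup>2 - (norm (x - y))\<^sup>2)
        \<longlonglongrightarrow> (norm (flow t x - y))\<^sup>2 - (norm (x - y))\<^sup>2"
      using flow_tendsto[OF w t] unfolding n_def r_def by (intro tendsto_intros)
    show "(\<lambda>k. 2 * (real (n t k) * r k) * (inner v (y - x) + norm v * norm w * (real (n t k) * r k)))
       \<longlonglongrightarrow> 2 * t * (inner v (y - x) + norm v * norm w * t)"
      using step_count_tendsto[OF t] unfolding n_def r_def by (intro tendsto_intros)
  qed (use step[OF r0 order_refl] in blast)
qed

text \<open>The base point \<open>z\<close> is an end point of the secant, so that right and left difference
  quotients are treated at once.\<close>

lemma flow_secant: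
  assumes w: "w \<in> A x" and wM: "norm w \<le> M" and h: "0 < h" and r: "0 < r"
    and z: "z = x \<or> z = flow h x"
  shows "h * ((norm (yosida r z))\<^sup>2 - 3 * M\<^sup>2 * h / r) \<le> inner (x - flow h x) (yosida r z)"
proof -
  let ?u = "flow h x" and ?a = "yosida r z" and ?y = "resolvent r z"
  have M: "0 \<le> M" using wM norm_ge_zero[of w] by linarith
  have aM: "norm ?a \<le> M"
  proof -
    have "norm ?a \<le> norm w"
      using z yosida_le[OF r w] yosida_le[OF r flow_mem(1)[OF w, of h]] flow_mem(2)[OF w, of h] h
      by (auto intro: order_trans)
    with wM show ?thesis by simp
  qed
  have ux: "norm (?u - x) \<le> M * h"
    using flow_lipschitz[OF w, of h 0] h mult_right_mono[OF wM, of h] by (auto intro: order_trans)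
  have evi: "(norm (?u - ?y))\<^sup>2 - (norm (x - ?y))\<^sup>2 \<le> 2 * h * (inner ?a (?y - x) + norm ?a * norm w * h)"
    by (rule flow_evi[OF w yosida_mem[OF r]]) (use h in simp)
  have yz: "z - ?y = r *\<^sub>R ?a" by (rule diff_resolvent[OF r])
  have "norm ?a * norm w \<le> M * M" using aM wM M by (intro mult_mono) auto
  then have aw: "norm ?a * norm w * h \<le> M\<^sup>2 * h" using h by (simp add: power2_eq_square)
  have diff: "(norm (?u - ?y))\<^sup>2 - (norm (x - ?y))\<^sup>2 = inner (?u - x) (?u + x - 2 *\<^sub>R ?y)"
    by (simp add: power2_norm_eq_inner inner_diff_left inner_diff_right inner_add_right inner_commute)
  have sq: "inner (?u - x) (?u - x) \<le> M\<^sup>2 * h\<^sup>2"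
    using power_mono[OF ux, of 2] by (simp add: power2_norm_eq_inner power_mult_distrib)
  \<comment> \<open>The difference of squares is 2 <u - x, c - y> with c the midpoint of x and u;
    moving c to either end point changes it by |u - x|^2, which is of second order in h.\<close>
  have sec: "2 * inner (?u - x) (z - ?y) \<le> (norm (?u - ?y))\<^sup>2 - (norm (x - ?y))\<^sup>2 + M\<^sup>2 * h\<^sup>2"
  proof -
    have "2 * inner (?u - x) (z - ?y) \<le> inner (?u - x) (?u + x - 2 *\<^sub>R ?y) + inner (?u - x) (?u - x)"
      using z
    proof
      assume "z = x"
      then show ?thesis
        by (simp only:) (use inner_ge_zero[of "?u - x"] in \<open>simp add: inner_diff_left inner_diff_right inner_add_right inner_commute\<close>)
    next
      assume "z = ?u"
      then show ?thesis
        by (simp add: inner_diff_left inner_diff_right inner_add_right inner_commute)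
    qed
    with diff sq show ?thesis by linarith
  qed
  have "inner ?a (?y - x) = inner ?a (z - x) - r * (norm ?a)\<^sup>2"
  proof -
    have "?y - x = (z - x) - r *\<^sub>R ?a" using yz by (simp add: algebra_simps)
    then show ?thesis by (simp only:) (simp add: inner_diff_right power2_norm_eq_inner)
  qed
  moreover have "inner ?a (z - x) \<le> M\<^sup>2 * h"
  proof -
    have "inner ?a (z - x) \<le> norm ?a * norm (z - x)" by (rule norm_cauchy_schwarz)
    also have "\<dots> \<le> M * (M * h)"
      using z aM ux M h by (intro mult_mono) auto
    finally show ?thesis by (simp add: power2_eq_square)
  qed
  ultimately have "inner ?a (?y - x) + norm ?a * norm w * h \<le> 2 * M\<^sup>2 * h - r * (norm ?a)\<^sup>2"
    using aw by linarith
  then have "2 * h * (inner ?a (?y - x) + norm ?a * norm w * h) \<le> 2 * h * (2 * M\<^sup>2 * h - r * (norm ?a)\<^sup>2)"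
    using h by (intro mult_left_mono) auto
  with evi sec have "2 * inner (?u - x) (z - ?y) \<le> 2 * h * (2 * M\<^sup>2 * h - r * (norm ?a)\<^sup>2) + M\<^sup>2 * h\<^sup>2"
    by linarith
  then have "r * inner (?u - x) ?a \<le> h * (2 * M\<^sup>2 * h - r * (norm ?a)\<^sup>2) + M\<^sup>2 * h\<^sup>2 / 2"
    by (simp add: yz)
  \<comment> \<open>Two units of M^2 h come from the drift bounds and one half from the secant; 5/2
    is rounded up to 3.\<close>
  also have "\<dots> \<le> h * (3 * M\<^sup>2 * h - r * (norm ?a)\<^sup>2)"
    using h M by (simp add: algebra_simps power2_eq_square)
  finally have "inner (?u - x) ?a \<le> h * (3 * M\<^sup>2 * h - r * (norm ?a)\<^sup>2) / r"
    using r by (simp add: field_simps)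
  also have "\<dots> = - (h * ((norm ?a)\<^sup>2 - 3 * M\<^sup>2 * h / r))"
    using r by (simp add: field_simps)
  finally show ?thesis by (simp add: inner_diff_left)
qed

text \<open>By the semigroup law the flow can be restarted at time s, and \<open>flow_mem\<close>
  bounds later minimal norms by the norm of the minimal section there.\<close>

lemma norm_min_section_flow_antimono:
  assumes w: "w \<in> A x" and "0 \<le> s" "s \<le> t"
  shows "norm (min_section (flow t x)) \<le> norm (min_section (flow s x))"
  using flow_add[OF w, of s "t - s"] flow_mem(2)[OF flow_mem(1)[OF w, of s], of "t - s"] assms
  by simp

lemma flow_has_vector_derivative:
  assumes w: "w \<in> A x" and t: "0 < t"
    and cont: "isCont (\<lambda>s. norm (min_section (flow s x))) t"
  shows "((\<lambda>s. flow s x) has_vector_derivative - min_section (flow t x)) (at t)"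
proof -
  define g where "g s = norm (min_section (flow s x))" for s
  define a where "a = min_section (flow t x)"
  define M where "M = 1 + norm w"
  have M: "0 < M" by (simp add: M_def add_pos_nonneg)
  have gM: "g s \<le> M" if "0 \<le> s" for s
    using flow_mem(2)[OF w that] by (simp add: g_def M_def)
  have aM: "norm a \<le> M" using gM[of t] t by (simp add: a_def g_def)
  \<comment> \<open>The times \<open>s\<close> and \<open>s + h\<close> enclose \<open>t\<close> at
    one end. The defect has three sources, each given a third: the Yosida error, the secant error of
    order h / r, and the change of the minimal norm from \<open>s\<close> to \<open>t\<close>. The
    last vanishes for s = t, so continuity is used only to the left of \<open>t\<close>.\<close>
  have est: "(norm (flow (s + h) x - flow s x + h *\<^sub>R a))\<^sup>2 \<le> e\<^sup>2 * h\<^sup>2"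
    if sh: "0 \<le> s" "0 < h" "t = s \<or> t = s + h" and r: "0 < r"
      and r1: "6 * M * norm (a - yosida r (flow t x)) \<le> e\<^sup>2 / 3" and h1: "6 * M\<^sup>2 * h / r \<le> e\<^sup>2 / 3"
      and g1: "(g s)\<^sup>2 - (g t)\<^sup>2 \<le> e\<^sup>2 / 3" for s h r e
  proof -
    let ?p = "flow s x" and ?q = "flow (s + h) x"
    define b where "b = yosida r (flow t x)"
    define k where "k = norm (a - b)"
    have p: "min_section ?p \<in> A ?p" by (rule flow_mem[OF w sh(1)])
    have q: "?q = flow h ?p" using flow_add[OF w sh(1), of h] sh by simp
    have t0: "0 \<le> t" using t by simp
    have "h * ((norm b)\<^sup>2 - 3 * M\<^sup>2 * h / r) \<le> inner (?p - ?q) b"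
      unfolding q b_def
    proof (rule flow_secant[OF p _ sh(2) r])
      show "norm (min_section ?p) \<le> M" using gM[OF sh(1)] by (simp add: g_def)
      show "flow t x = ?p \<or> flow t x = flow h ?p" using sh(3) q by auto
    qed
    moreover have pq: "norm (?p - ?q) \<le> g s * h"
      using flow_lipschitz[OF p, of h 0] sh by (simp add: q g_def norm_minus_commute)
    then have pqM: "norm (?p - ?q) \<le> M * h"
      using gM[OF sh(1)] sh by (meson mult_right_mono order_trans less_imp_le)
    have "inner (?p - ?q) b \<le> inner (?p - ?q) a + M * h * k"
    proof -
      have "inner (?p - ?q) (b - a) \<le> norm (?p - ?q) * norm (b - a)" by (rule norm_cauchy_schwarz)
      also have "\<dots> \<le> M * h * k" using pqM by (simp add: k_def norm_minus_commute mult_right_mono)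
      finally show ?thesis by (simp add: inner_diff_right)
    qed
    ultimately have 1: "h * ((norm b)\<^sup>2 - 3 * M\<^sup>2 * h / r) - M * h * k \<le> inner (?p - ?q) a" by linarith
    have bM: "norm b \<le> M"
      using yosida_le[OF r flow_mem(1)[OF w t0]] gM[OF t0] by (simp add: g_def b_def)
    have "(norm a)\<^sup>2 - (norm b)\<^sup>2 = (norm a - norm b) * (norm a + norm b)"
      by (simp add: power2_eq_square algebra_simps)
    also have "\<dots> \<le> k * (M + M)"
      by (intro mult_mono add_mono aM bM) (auto simp: k_def norm_triangle_ineq2)
    also have "\<dots> = 2 * M * k" by simp
    finally have 2: "h\<^sup>2 * ((norm a)\<^sup>2 - (norm b)\<^sup>2) \<le> h\<^sup>2 * (2 * M * k)"
      by (intro mult_left_mono) auto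
    have 3: "(norm (?p - ?q))\<^sup>2 \<le> (g s)\<^sup>2 * h\<^sup>2"
      using power_mono[OF pq, of 2] by (simp add: power_mult_distrib)
    have 4: "2 * h * (h * ((norm b)\<^sup>2 - 3 * M\<^sup>2 * h / r) - M * h * k) \<le> 2 * h * inner (?p - ?q) a"
      using sh by (intro mult_left_mono 1) auto
    have "(norm (?q - ?p + h *\<^sub>R a))\<^sup>2 = (norm (?p - ?q))\<^sup>2 - 2 * h * inner (?p - ?q) a + h\<^sup>2 * (norm a)\<^sup>2"
      unfolding power2_norm_eq_inner
      by (simp add: inner_diff_left inner_diff_right inner_add_left inner_add_right inner_commute algebra_simps power2_eq_square)
    also have "\<dots> \<le> (g s)\<^sup>2 * h\<^sup>2 - 2 * h * (h * ((norm b)\<^sup>2 - 3 * M\<^sup>2 * h / r) - M * h * k) + h\<^sup>2 * (norm a)\<^sup>2"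
      using 3 4 by linarith
    also have "\<dots> = h\<^sup>2 * ((g s)\<^sup>2 - (norm a)\<^sup>2) + 2 * (h\<^sup>2 * ((norm a)\<^sup>2 - (norm b)\<^sup>2))
        + h\<^sup>2 * (6 * M\<^sup>2 * h / r) + h\<^sup>2 * (2 * M * k)"
      using r by (simp add: field_simps power2_eq_square)
    \<comment> \<open>The Yosida error k enters as 4 M k through |a|^2 - |b|^2 and as 2 M k through
      replacing b by a in the inner product.\<close>
    also have "\<dots> \<le> h\<^sup>2 * ((g s)\<^sup>2 - (norm a)\<^sup>2) + h\<^sup>2 * (6 * M\<^sup>2 * h / r) + h\<^sup>2 * (6 * M * k)"
      using 2 by linarith
    also have "\<dots> \<le> h\<^sup>2 * (e\<^sup>2 / 3) + h\<^sup>2 * (e\<^sup>2 / 3) + h\<^sup>2 * (e\<^sup>2 / 3)"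
      using r1 h1 g1 by (intro add_mono mult_left_mono) (auto simp: k_def b_def a_def g_def)
    finally show ?thesis by (simp add: mult.commute)
  qed
  show ?thesis
    unfolding has_vector_derivative_def has_derivative_at_alt
  proof (intro conjI allI impI)
    fix e :: real assume e: "0 < e"
    \<comment> \<open>The order matters: \<open>e\<close> fixes the Yosida step \<open>r\<close>
      first, and only then is the time step made small relative to \<open>r\<close>.\<close>
    have "0 < e\<^sup>2 / (18 * M)" using e M by simp
    then obtain n where n: "norm (yosida (1 / real (Suc n)) (flow t x) - a) < e\<^sup>2 / (18 * M)"
      using LIMSEQ_D[OF yosida_tendsto[OF flow_mem(1)[OF w, of t]]] t unfolding a_def
      by (metis less_eq_real_def order_refl)
    define r where "r = 1 / real (Suc n)"
    have r: "0 < r" by (simp add: r_def)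
    have "norm (a - yosida r (flow t x)) < e\<^sup>2 / (18 * M)"
      using n by (simp add: r_def norm_minus_commute)
    then have r1: "6 * M * norm (a - yosida r (flow t x)) \<le> e\<^sup>2 / 3"
      using M by (simp add: field_simps)
    have "isCont (\<lambda>s. (g s)\<^sup>2) t" by (rule continuous_power[OF cont[folded g_def]])
    then obtain d where d: "0 < d" "\<And>s. \<bar>s - t\<bar> < d \<Longrightarrow> \<bar>(g s)\<^sup>2 - (g t)\<^sup>2\<bar> < e\<^sup>2 / 3"
      unfolding continuous_at_eps_delta using e by (metis dist_real_def zero_less_divide_iff zero_less_numeral zero_less_power)
    \<comment> \<open>The entry \<open>t\<close> keeps times to the left nonnegative; the last entry
      controls the error of order h / r.\<close>
    define d' where "d' = min d (min t (r * e\<^sup>2 / (18 * M\<^sup>2)))"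
    have d': "0 < d'" "d' \<le> d" "d' \<le> t" "d' \<le> r * e\<^sup>2 / (18 * M\<^sup>2)" using d t r e M by (auto simp: d'_def)
    have hd: "6 * M\<^sup>2 * h / r \<le> e\<^sup>2 / 3" if "h \<le> d'" for h
    proof -
      have "18 * M\<^sup>2 * h \<le> r * e\<^sup>2"
        using order_trans[OF that d'(4)] M by (simp add: field_simps)
      then show ?thesis using r by (simp add: field_simps)
    qed
    have "norm (flow y x - flow t x - (y - t) *\<^sub>R - min_section (flow t x)) \<le> e * norm (y - t)"
      if y: "norm (y - t) < d'" for y
    proof (cases y t rule: linorder_cases)
      case less
      have h1: "6 * M\<^sup>2 * (t - y) / r \<le> e\<^sup>2 / 3"
        using y less by (intro hd) simp
      have "(norm (flow (y + (t - y)) x - flow y x + (t - y) *\<^sub>R a))\<^sup>2 \<le> e\<^sup>2 * (t - y)\<^sup>2"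
      proof (rule est[OF _ _ _ r r1 h1])
        have "\<bar>(g y)\<^sup>2 - (g t)\<^sup>2\<bar> < e\<^sup>2 / 3" using y d'(2) by (intro d(2)) simp
        then show "(g y)\<^sup>2 - (g t)\<^sup>2 \<le> e\<^sup>2 / 3" by linarith
        show "0 \<le> y" using less d'(3) y by simp
        show "0 < t - y" using less by simp
      qed simp
      then have "(norm (flow t x - flow y x + (t - y) *\<^sub>R a))\<^sup>2 \<le> (e * (t - y))\<^sup>2"
        by (simp add: power_mult_distrib)
      then have "norm (flow t x - flow y x + (t - y) *\<^sub>R a) \<le> e * (t - y)"
        by (rule power2_le_imp_le) (use less e in simp)
      moreover have "flow y x - flow t x - (y - t) *\<^sub>R - a = - (flow t x - flow y x + (t - y) *\<^sub>R a)"
        by (simp add: algebra_simps)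
      moreover have "\<bar>y - t\<bar> = t - y" using less by simp
      ultimately show ?thesis unfolding a_def by (simp only: norm_minus_cancel real_norm_def)
    next
      case greater
      have h1: "6 * M\<^sup>2 * (y - t) / r \<le> e\<^sup>2 / 3"
        using y greater by (intro hd) simp
      have "(norm (flow (t + (y - t)) x - flow t x + (y - t) *\<^sub>R a))\<^sup>2 \<le> e\<^sup>2 * (y - t)\<^sup>2"
        using greater t by (intro est[OF _ _ _ r r1 h1]) auto
      then have "(norm (flow y x - flow t x + (y - t) *\<^sub>R a))\<^sup>2 \<le> (e * (y - t))\<^sup>2"
        by (simp add: power_mult_distrib)
      then have "norm (flow y x - flow t x + (y - t) *\<^sub>R a) \<le> e * (y - t)"
        by (rule power2_le_imp_le) (use greater e in simp)
      then show ?thesis using greater unfolding a_def by simp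
    qed simp
    then show "\<exists>d>0. \<forall>y. norm (y - t) < d \<longrightarrow>
        norm (flow y x - flow t x - (y - t) *\<^sub>R - min_section (flow t x)) \<le> e * norm (y - t)"
      using d'(1) by blast
  qed (rule bounded_linear_scaleR_left)
qed

lemma AE_flow_has_vector_derivative:
  assumes w: "w \<in> A x"
  shows "AE t in lborel. 0 < t \<longrightarrow> ((\<lambda>s. flow s x) has_vector_derivative - min_section (flow t x)) (at t)"
proof -
  define g where "g s = - norm (min_section (flow s x))" for s
  have "mono_on {0<..} g"
    by (rule mono_onI) (use norm_min_section_flow_antimono[OF w] in \<open>auto simp: g_def\<close>)
  then have "countable {t \<in> {0<..}. \<not> isCont g t}"
    using mono_on_ctble_discont_open[of "{0<..}" g] by auto
  then have "AE t in lborel. t \<notin> {t \<in> {0<..}. \<not> isCont g t}"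
    by (intro AE_not_in countable_imp_null_set_lborel)
  then show ?thesis
  proof eventually_elim
    case (elim t)
    show ?case
    proof
      assume t: "0 < t"
      with elim have "isCont g t" by auto
      from continuous_minus[OF this] have "isCont (\<lambda>s. norm (min_section (flow s x))) t"
        by (simp add: g_def)
      then show "((\<lambda>s. flow s x) has_vector_derivative - min_section (flow t x)) (at t)"
        by (rule flow_has_vector_derivative[OF w t])
    qed
  qed
qed

end

section \<open>Subdifferentials of constrained convex functionals\<close>

text \<open>The subdifferential of \<open>E\<close> plus the indicator of \<open>K\<close> in purely
  real arithmetic; the conjunct \<open>x \<in> K\<close> stands in for the conventions on infinite
  values.\<close>

definition constrained_subdifferential :: "('a::real_inner \<Rightarrow> real) \<Rightarrow> 'a set \<Rightarrow> 'a \<Rightarrow> 'a set" where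
  "constrained_subdifferential E K x = {w. x \<in> K \<and> (\<forall>z\<in>K. inner w (z - x) \<le> E z - E x)}"

text \<open>A subgradient at the convex combination itself suffices: its increments towards
  \<open>x\<close> and \<open>y\<close>, weighted by 1 - t and t, cancel.\<close>

lemma convex_on_subgradient:
  fixes E :: "'a::real_inner \<Rightarrow> real"
  assumes "convex K" and sub: "\<And>x. x \<in> K \<Longrightarrow> constrained_subdifferential E K x \<noteq> {}"
  shows "convex_on K E"
proof (rule convex_onI[OF _ assms(1)])
  fix t x y assume t: "0 < (t::real)" "t < 1" and xy: "x \<in> K" "y \<in> K"
  let ?p = "(1 - t) *\<^sub>R x + t *\<^sub>R y"
  have "?p \<in> K" using assms(1) t xy by (intro convexD) auto
  then obtain g where g: "\<And>z. z \<in> K \<Longrightarrow> inner g (z - ?p) \<le> E z - E ?p"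
    using sub by (fastforce simp: constrained_subdifferential_def)
  have "(1 - t) * inner g (x - ?p) + t * inner g (y - ?p) \<le> (1 - t) * (E x - E ?p) + t * (E y - E ?p)"
    using t xy by (intro add_mono mult_left_mono g) auto
  moreover have "(1 - t) * inner g (x - ?p) + t * inner g (y - ?p) = 0"
    by (simp add: inner_diff_right inner_add_right algebra_simps)
  ultimately show "E ?p \<le> (1 - t) * E x + t * E y" by (simp add: algebra_simps)
qed

text \<open>Strong limits suffice: the quadratic term makes a minimising sequence Cauchy, and a
  subgradient at its limit does the work of lower semicontinuity.\<close>

lemma proximal_point_exists:
  fixes E :: "'a::{real_inner, complete_space} \<Rightarrow> real"
  assumes K: "closed K" "convex K" "K \<noteq> {}"
    and sub: "\<And>x. x \<in> K \<Longrightarrow> constrained_subdifferential E K x \<noteq> {}" and r: "0 < r"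
  obtains z where "z \<in> K" "\<And>y. y \<in> K \<Longrightarrow> E z + (norm (z - x))\<^sup>2 / (2 * r) \<le> E y + (norm (y - x))\<^sup>2 / (2 * r)"
proof -
  define f where "f z = E z + (norm (z - x))\<^sup>2 / (2 * r)" for z
  have cvx: "convex_on K E" by (rule convex_on_subgradient[OF K(2) sub])
  obtain x0 where x0: "x0 \<in> K" using K(3) by blast
  then obtain g where g: "\<And>z. z \<in> K \<Longrightarrow> inner g (z - x0) \<le> E z - E x0"
    using sub by (fastforce simp: constrained_subdifferential_def)
  have low: "E x0 + inner g (x - x0) - r * (norm g)\<^sup>2 / 2 \<le> f z" if z: "z \<in> K" for z
  proof -
    \<comment> \<open>Completing the square: the affine minorant at \<open>x0\<close> plus the
      quadratic term is bounded below, so the infimum \<open>m\<close> is a genuine one.\<close>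
    have "0 \<le> (norm (r *\<^sub>R g + (z - x)))\<^sup>2 / (2 * r)" using r by simp
    also have "\<dots> = r * (norm g)\<^sup>2 / 2 + inner g (z - x) + (norm (z - x))\<^sup>2 / (2 * r)"
      unfolding power2_norm_eq_inner inner_add_left inner_add_right inner_scaleR_left inner_scaleR_right
      using r by (simp add: inner_commute field_simps)
    finally have "- r * (norm g)\<^sup>2 / 2 \<le> inner g (z - x) + (norm (z - x))\<^sup>2 / (2 * r)" by simp
    moreover have "inner g (z - x0) = inner g (z - x) + inner g (x - x0)" by (simp add: inner_diff_right)
    ultimately show ?thesis using g[OF z] by (simp add: f_def)
  qed
  define m where "m = (INF z\<in>K. f z)"
  have bdd: "bdd_below (f ` K)" using low by (rule bdd_belowI2)
  have m_le: "m \<le> f z" if "z \<in> K" for z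
    unfolding m_def by (rule cINF_lower[OF bdd that])
  have "\<exists>z\<in>K. f z < m + 1 / real (Suc n)" for n
    using cINF_less_iff[OF K(3) bdd, of "m + 1 / real (Suc n)"] by (simp add: m_def)
  then obtain s where s: "\<And>n. s n \<in> K" "\<And>n. f (s n) < m + 1 / real (Suc n)" by metis
  \<comment> \<open>At the midpoint \<open>f\<close> is at least \<open>m\<close>, while convexity
    of \<open>E\<close> and the parallelogram law bound it above by the mean of \<open>f a\<close>
    and \<open>f b\<close> minus |a - b|^2 / (8 r).\<close>
  have mid: "(norm (a - b))\<^sup>2 \<le> 4 * r * (f a + f b - 2 * m)" if ab: "a \<in> K" "b \<in> K" for a b
  proof -
    let ?c = "(1 - 1/2) *\<^sub>R a + (1/2) *\<^sub>R b"
    have c: "?c \<in> K" using ab K(2) by (intro convexD) auto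
    have "E ?c \<le> (1 - 1/2) * E a + (1/2) * E b"
      by (rule convex_onD[OF cvx _ _ ab]) auto
    have par: "4 * (norm (?c - x))\<^sup>2 + (norm (a - b))\<^sup>2 = 2 * (norm (a - x))\<^sup>2 + 2 * (norm (b - x))\<^sup>2"
      unfolding power2_norm_eq_inner
      by (simp add: inner_diff_left inner_diff_right inner_add_left inner_add_right inner_commute field_simps)
    have "(norm (?c - x))\<^sup>2 / (2 * r) = ((norm (a - x))\<^sup>2 / (2 * r) + (norm (b - x))\<^sup>2 / (2 * r)) / 2
        - (norm (a - b))\<^sup>2 / (8 * r)"
    proof -
      have *: "C / (2 * r) = (A / (2 * r) + B / (2 * r)) / 2 - D / (8 * r)"
        if "4 * C + D = 2 * A + 2 * B" for A B C D
      proof -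
        have C: "C = (2 * A + 2 * B - D) / 4" using that by simp
        show ?thesis unfolding C using r by (simp add: field_simps)
      qed
      from par show ?thesis by (rule *)
    qed
    have "f ?c \<le> (f a + f b) / 2 - (norm (a - b))\<^sup>2 / (8 * r)"
    proof -
      have *: "e + c' \<le> (e1 + d1 + (e2 + d2)) / 2 - d"
        if "e \<le> (1 - 1/2) * e1 + (1/2) * e2" "c' = (d1 + d2) / 2 - d" for e e1 e2 c' d1 d2 d :: real
        using that by (simp add: field_simps)
      show ?thesis unfolding f_def by (rule *) fact+
    qed
    with m_le[OF c] have "(norm (a - b))\<^sup>2 / (8 * r) \<le> (f a + f b) / 2 - m" by linarith
    then show ?thesis using r by (simp add: field_simps)
  qed
  have "Cauchy s"
  proof (rule CauchyI)
    fix e :: real assume e: "0 < e"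
    obtain N where N: "0 < N" "1 / real N < e\<^sup>2 / (8 * r)"
      using real_arch_inverse[of "e\<^sup>2 / (8 * r)"] e r by (auto simp: inverse_eq_divide)
    have "norm (s i - s j) < e" if ij: "N \<le> i" "N \<le> j" for i j
    proof -
      have "1 / real (Suc k) \<le> 1 / real N" if "N \<le> k" for k using N(1) that by (intro frac_le) auto
      then have "f (s i) < m + e\<^sup>2 / (8 * r)" "f (s j) < m + e\<^sup>2 / (8 * r)"
        using s(2)[of i] s(2)[of j] N(2) ij by (meson add_left_mono order_less_le_trans order_le_less_trans less_imp_le add_strict_left_mono order_less_trans)+
      then have "f (s i) + f (s j) - 2 * m < e\<^sup>2 / (4 * r)" by simp
      then have "4 * r * (f (s i) + f (s j) - 2 * m) < 4 * r * (e\<^sup>2 / (4 * r))"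
        using r by (intro mult_strict_left_mono) auto
      also have "\<dots> = e\<^sup>2" using r by simp
      finally have "(norm (s i - s j))\<^sup>2 < e\<^sup>2"
        using mid[OF s(1) s(1), of i j] by linarith
      then show ?thesis using e by (simp add: power2_less_imp_less)
    qed
    then show "\<exists>M. \<forall>i\<ge>M. \<forall>j\<ge>M. norm (s i - s j) < e" by blast
  qed
  then obtain z where z: "s \<longlonglongrightarrow> z" using Cauchy_convergent_iff convergent_def by blast
  have zK: "z \<in> K" using K(1) s(1) z by (metis closed_sequentially)
  then obtain h where h: "\<And>y. y \<in> K \<Longrightarrow> inner h (y - z) \<le> E y - E z"
    using sub by (fastforce simp: constrained_subdifferential_def)
  have "f z \<le> m"
  proof (rule LIMSEQ_le)
    have "(\<lambda>n. E z + inner h (s n - z) + (norm (s n - x))\<^sup>2 / (2 * r)) \<longlonglongrightarrow> E z + inner h (z - z) + (norm (z - x))\<^sup>2 / (2 * r)"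
      using r by (intro tendsto_intros z) auto
    then show "(\<lambda>n. E z + inner h (s n - z) + (norm (s n - x))\<^sup>2 / (2 * r)) \<longlonglongrightarrow> f z"
      by (simp add: f_def)
    have "(\<lambda>n. m + inverse (real (Suc n))) \<longlonglongrightarrow> m + 0"
      by (intro tendsto_intros LIMSEQ_inverse_real_of_nat)
    then show "(\<lambda>n. m + 1 / real (Suc n)) \<longlonglongrightarrow> m" by (simp add: inverse_eq_divide)
    have "E z + inner h (s n - z) + (norm (s n - x))\<^sup>2 / (2 * r) \<le> m + 1 / real (Suc n)" for n
      using h[OF s(1)[of n]] s(2)[of n] unfolding f_def by linarith
    then show "\<exists>N. \<forall>n\<ge>N. E z + inner h (s n - z) + (norm (s n - x))\<^sup>2 / (2 * r) \<le> m + 1 / real (Suc n)"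
      by blast
  qed
  then have "f z \<le> f y" if "y \<in> K" for y using m_le[OF that] by simp
  with zK that show ?thesis unfolding f_def by blast
qed

text \<open>For the range condition the proximal point z is compared with z + t (y - z). After
  division by t the quadratic remainder is of order t, and t = 1 / (n + 1) tends to 0.\<close>

lemma maximal_monotone_constrained_subdifferential:
  fixes E :: "'a::{real_inner, complete_space} \<Rightarrow> real"
  assumes K: "closed K" "convex K" "K \<noteq> {}"
    and sub: "\<And>x. x \<in> K \<Longrightarrow> constrained_subdifferential E K x \<noteq> {}"
  shows "maximal_monotone (constrained_subdifferential E K)"
proof
  fix w x v y
  assume "w \<in> constrained_subdifferential E K x" "v \<in> constrained_subdifferential E K y"
  then have "inner w (y - x) \<le> E y - E x" "inner v (x - y) \<le> E x - E y"
    by (auto simp: constrained_subdifferential_def)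
  then show "0 \<le> inner (w - v) (x - y)" by (simp add: inner_diff_left inner_diff_right)
next
  fix r :: real and x :: 'a assume r: "0 < r"
  obtain z where z: "z \<in> K"
    and min: "\<And>y. y \<in> K \<Longrightarrow> E z + (norm (z - x))\<^sup>2 / (2 * r) \<le> E y + (norm (y - x))\<^sup>2 / (2 * r)"
    using proximal_point_exists[OF K sub r] by blast
  have "inner ((1 / r) *\<^sub>R (x - z)) (y - z) \<le> E y - E z" if y: "y \<in> K" for y
  proof (rule LIMSEQ_le_const)
    have "(\<lambda>n. E y - E z + inverse (real (Suc n)) * ((norm (y - z))\<^sup>2 / (2 * r)))
      \<longlonglongrightarrow> E y - E z + 0 * ((norm (y - z))\<^sup>2 / (2 * r))"
      by (intro tendsto_intros LIMSEQ_inverse_real_of_nat)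
    then show "(\<lambda>n. E y - E z + inverse (real (Suc n)) * ((norm (y - z))\<^sup>2 / (2 * r))) \<longlonglongrightarrow> E y - E z"
      by simp
    have "inner ((1 / r) *\<^sub>R (x - z)) (y - z) \<le> E y - E z + t * ((norm (y - z))\<^sup>2 / (2 * r))"
      if t: "0 < t" "t \<le> 1" for t
    proof -
      let ?p = "(1 - t) *\<^sub>R z + t *\<^sub>R y"
      have "?p \<in> K" using K(2) z y t by (intro convexD) auto
      note min[OF this]
      also have "E ?p \<le> (1 - t) * E z + t * E y"
        using convex_on_subgradient[OF K(2) sub] t z y by (intro convex_onD) auto
      also have "?p - x = (z - x) + t *\<^sub>R (y - z)" by (simp add: algebra_simps)
      also have "(norm ((z - x) + t *\<^sub>R (y - z)))\<^sup>2
          = (norm (z - x))\<^sup>2 + 2 * t * inner (z - x) (y - z) + t\<^sup>2 * (norm (y - z))\<^sup>2"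
        unfolding power2_norm_eq_inner inner_add_left inner_add_right inner_scaleR_left inner_scaleR_right
        by (simp add: inner_commute power2_eq_square algebra_simps)
      finally have *: "E z + (norm (z - x))\<^sup>2 / (2 * r) \<le> (1 - t) * E z + t * E y
          + ((norm (z - x))\<^sup>2 + 2 * t * inner (z - x) (y - z) + t\<^sup>2 * (norm (y - z))\<^sup>2) / (2 * r)"
        by simp
      have "0 \<le> t * (E y - E z + inner (z - x) (y - z) / r + t * ((norm (y - z))\<^sup>2 / (2 * r)))"
      proof -
        have "((norm (z - x))\<^sup>2 + 2 * t * inner (z - x) (y - z) + t\<^sup>2 * (norm (y - z))\<^sup>2) / (2 * r)
          = (norm (z - x))\<^sup>2 / (2 * r) + t * (inner (z - x) (y - z) / r) + t * (t * ((norm (y - z))\<^sup>2 / (2 * r)))"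
          using r by (simp add: add_divide_distrib power2_eq_square)
        with * show ?thesis by (simp add: algebra_simps)
      qed
      with t have "0 \<le> E y - E z + inner (z - x) (y - z) / r + t * ((norm (y - z))\<^sup>2 / (2 * r))"
        by (simp add: zero_le_mult_iff)
      moreover have "inner ((1 / r) *\<^sub>R (x - z)) (y - z) = - (inner (z - x) (y - z) / r)"
        using r by (simp add: inner_diff_left field_simps)
      ultimately show ?thesis by linarith
    qed
    then show "\<exists>N. \<forall>n\<ge>N. inner ((1 / r) *\<^sub>R (x - z)) (y - z)
        \<le> E y - E z + inverse (real (Suc n)) * ((norm (y - z))\<^sup>2 / (2 * r))"
      by (auto simp: inverse_le_1_iff intro!: exI[of _ 0])
  qed
  with z show "\<exists>z. (1 / r) *\<^sub>R (x - z) \<in> constrained_subdifferential E K z"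
    by (auto simp: constrained_subdifferential_def)
qed

section \<open>Absolutely continuous curves and uniqueness\<close>

lemma absolutely_continuous_curve_lipschitz:
  assumes L: "\<And>s t. s \<in> S \<Longrightarrow> t \<in> S \<Longrightarrow> dist (X s) (X t) \<le> L * \<bar>s - t\<bar>"
  shows "absolutely_continuous_curve S X"
  unfolding absolutely_continuous_curve_def
proof (intro allI impI)
  fix e :: real assume e: "0 < e"
  \<comment> \<open>Raising the constant to at least 1 permits division by it even if
    \<open>L\<close> is 0.\<close>
  define M where "M = max L 1"
  have M: "0 < M" "L \<le> M" by (auto simp: M_def)
  have "(\<Sum>k\<in>d. dist (X (Sup k)) (X (Inf k))) < e"
    if d: "d division_of T \<and> T \<subseteq> S \<and> (\<Sum>k\<in>d. Sup k - Inf k) < e / M" for d T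
  proof -
    have "(\<Sum>k\<in>d. dist (X (Sup k)) (X (Inf k))) \<le> (\<Sum>k\<in>d. M * (Sup k - Inf k))"
    proof (rule sum_mono)
      fix k assume k: "k \<in> d"
      with d obtain a b where ab: "k = {a..b}" "a \<le> b" "k \<subseteq> S"
        by (metis atLeastatMost_empty_iff2 box_real(2) division_ofD(2,3,4) order_trans)
      then have "a \<in> S" "b \<in> S" by auto
      from L[OF this(2,1)] show "dist (X (Sup k)) (X (Inf k)) \<le> M * (Sup k - Inf k)"
        using ab M mult_right_mono[of L M "b - a"] by simp
    qed
    also have "\<dots> < M * (e / M)"
      using d M by (simp only: sum_distrib_left[symmetric]) (intro mult_strict_left_mono, auto)
    finally show ?thesis using M by simp
  qed
  then show "\<exists>\<delta>>0. \<forall>d T. d division_of T \<and> T \<subseteq> S \<and> (\<Sum>k\<in>d. Sup k - Inf k) < \<delta> \<longrightarrow>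
      (\<Sum>k\<in>d. dist (X (Sup k)) (X (Inf k))) < e"
    using e M by (intro exI[of _ "e / M"]) auto
qed

lemma absolutely_continuous_curve_imp_continuous_on:
  assumes "absolutely_continuous_curve {a..b} X"
  shows "continuous_on {a..b} X"
proof (rule continuous_onI)
  fix x e :: real assume x: "x \<in> {a..b}" and e: "0 < e"
  obtain d where d: "0 < d" and D: "\<And>p T. p division_of T \<Longrightarrow> T \<subseteq> {a..b} \<Longrightarrow> (\<Sum>k\<in>p. Sup k - Inf k) < d \<Longrightarrow>
        (\<Sum>k\<in>p. dist (X (Sup k)) (X (Inf k))) < e"
    using assms e unfolding absolutely_continuous_curve_def by meson
  have "dist (X x') (X x) \<le> e" if x': "x' \<in> {a..b}" "dist x' x < d" for x'
  proof -
    let ?l = "min x x'" and ?r = "max x x'"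
    have "{{?l..?r}} division_of {?l..?r}"
      by (metis box_real(2) division_of_self atLeastatMost_empty_iff2 max.cobounded1 min.cobounded1 order_trans)
    moreover have "{?l..?r} \<subseteq> {a..b}" using x x' by auto
    moreover have "(\<Sum>k\<in>{{?l..?r}}. Sup k - Inf k) < d"
      using x' by (auto simp: dist_real_def min_def max_def)
    ultimately have "(\<Sum>k\<in>{{?l..?r}}. dist (X (Sup k)) (X (Inf k))) < e" by (rule D)
    then show ?thesis by (auto simp: min_def max_def dist_commute split: if_splits)
  qed
  then show "\<exists>d>0. \<forall>x'\<in>{a..b}. dist x' x < d \<longrightarrow> dist (X x') (X x) \<le> e"
    using d by blast
qed

text \<open>Continuity on a compact interval bounds the distance by some M, and squaring is
  Lipschitz with constant 2 M on [0, M]; hence the tolerance e / (4 M) for each curve.\<close>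

lemma absolutely_continuous_curve_norm_diff_square:
  fixes X Y :: "real \<Rightarrow> 'a::real_normed_vector"
  assumes X: "absolutely_continuous_curve {a..b} X" and Y: "absolutely_continuous_curve {a..b} Y"
  shows "absolutely_continuous_curve {a..b} (\<lambda>t. (norm (X t - Y t))\<^sup>2)"
proof -
  have "bounded ((\<lambda>t. X t - Y t) ` {a..b})"
    by (intro compact_imp_bounded compact_continuous_image continuous_intros
        absolutely_continuous_curve_imp_continuous_on X Y compact_Icc)
  then obtain M where M: "0 < M" "\<And>t. t \<in> {a..b} \<Longrightarrow> norm (X t - Y t) \<le> M"
    unfolding bounded_pos by auto
  have pt: "dist ((norm (X s - Y s))\<^sup>2) ((norm (X t - Y t))\<^sup>2) \<le> 2 * M * (dist (X s) (X t) + dist (Y s) (Y t))"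
    if "s \<in> {a..b}" "t \<in> {a..b}" for s t
  proof -
    let ?p = "norm (X s - Y s)" and ?q = "norm (X t - Y t)"
    have "\<bar>?p - ?q\<bar> \<le> norm ((X s - Y s) - (X t - Y t))" by (rule norm_triangle_ineq3)
    also have "(X s - Y s) - (X t - Y t) = (X s - X t) - (Y s - Y t)" by simp
    also have "norm \<dots> \<le> dist (X s) (X t) + dist (Y s) (Y t)"
      unfolding dist_norm by (rule norm_triangle_ineq4)
    finally have 1: "\<bar>?p - ?q\<bar> \<le> dist (X s) (X t) + dist (Y s) (Y t)" .
    have "dist (?p\<^sup>2) (?q\<^sup>2) = (?p + ?q) * \<bar>?p - ?q\<bar>"
      by (simp add: dist_real_def power2_eq_square square_diff_square_factored abs_mult)
    also have "\<dots> \<le> (2 * M) * (dist (X s) (X t) + dist (Y s) (Y t))"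
      using 1 M(2)[OF that(1)] M(2)[OF that(2)] M(1) by (intro mult_mono) auto
    finally show ?thesis .
  qed
  show ?thesis
    unfolding absolutely_continuous_curve_def
  proof (intro allI impI)
    fix e :: real assume e: "0 < e"
    have e': "0 < e / (4 * M)" using e M by simp
    obtain d1 where d1: "0 < d1" and D1: "\<And>p T. p division_of T \<Longrightarrow> T \<subseteq> {a..b} \<Longrightarrow> (\<Sum>k\<in>p. Sup k - Inf k) < d1 \<Longrightarrow>
        (\<Sum>k\<in>p. dist (X (Sup k)) (X (Inf k))) < e / (4 * M)"
      using X e' unfolding absolutely_continuous_curve_def by meson
    obtain d2 where d2: "0 < d2" and D2: "\<And>p T. p division_of T \<Longrightarrow> T \<subseteq> {a..b} \<Longrightarrow> (\<Sum>k\<in>p. Sup k - Inf k) < d2 \<Longrightarrow>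
        (\<Sum>k\<in>p. dist (Y (Sup k)) (Y (Inf k))) < e / (4 * M)"
      using Y e' unfolding absolutely_continuous_curve_def by meson
    have "(\<Sum>k\<in>p. dist ((norm (X (Sup k) - Y (Sup k)))\<^sup>2) ((norm (X (Inf k) - Y (Inf k)))\<^sup>2)) < e"
      if p: "p division_of T" "T \<subseteq> {a..b}" "(\<Sum>k\<in>p. Sup k - Inf k) < min d1 d2" for p T
    proof -
      have "(\<Sum>k\<in>p. dist ((norm (X (Sup k) - Y (Sup k)))\<^sup>2) ((norm (X (Inf k) - Y (Inf k)))\<^sup>2))
        \<le> (\<Sum>k\<in>p. 2 * M * (dist (X (Sup k)) (X (Inf k)) + dist (Y (Sup k)) (Y (Inf k))))"
      proof (rule sum_mono)
        fix k assume k: "k \<in> p"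
        obtain u v where "k = {u..v}" "k \<noteq> {}" "k \<subseteq> {a..b}"
          using division_ofD(2,3,4)[OF p(1)] k p(2) by (metis box_real(2) order_trans)
        then show "dist ((norm (X (Sup k) - Y (Sup k)))\<^sup>2) ((norm (X (Inf k) - Y (Inf k)))\<^sup>2)
          \<le> 2 * M * (dist (X (Sup k)) (X (Inf k)) + dist (Y (Sup k)) (Y (Inf k)))"
          by (intro pt) auto
      qed
      also have "\<dots> = 2 * M * ((\<Sum>k\<in>p. dist (X (Sup k)) (X (Inf k))) + (\<Sum>k\<in>p. dist (Y (Sup k)) (Y (Inf k))))"
        by (simp add: sum_distrib_left[symmetric] sum.distrib)
      also have "\<dots> < 2 * M * (e / (4 * M) + e / (4 * M))"
        using p M(1) by (intro mult_strict_left_mono add_strict_mono D1 D2) auto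
      also have "\<dots> = e" using M(1) by simp
      finally show ?thesis .
    qed
    then show "\<exists>\<delta>>0. \<forall>d T. d division_of T \<and> T \<subseteq> {a..b} \<and> (\<Sum>k\<in>d. Sup k - Inf k) < \<delta> \<longrightarrow>
      (\<Sum>k\<in>d. dist ((norm (X (Sup k) - Y (Sup k)))\<^sup>2) ((norm (X (Inf k) - Y (Inf k)))\<^sup>2)) < e"
      using d1 d2 by (intro exI[of _ "min d1 d2"]) auto
  qed
qed

text \<open>Intervals of a division overlap only at end points, so their lengths add up to the
  measure of the union. This turns an open set of small measure into an input for absolute
  continuity.\<close>

lemma sum_length_division_le_measure:
  fixes d :: "real set set"
  assumes d: "d division_of T" and "T \<subseteq> U" "open U" "emeasure lborel U < ennreal e"
  shows "(\<Sum>k\<in>d. Sup k - Inf k) < e"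
proof -
  have e: "0 < e" using assms(4) by (metis ennreal_neg linorder_not_le not_less_zero)
  have eq: "Sup k - Inf k = measure lebesgue k" if "k \<in> d" for k
    using division_ofD(3,4)[OF d that] by (auto simp: box_real(2) measure_completion)
  have "compact (\<Union>d)"
    using division_ofD(1,4)[OF d] by (intro compact_Union) auto
  then have "compact T" using division_ofD(6)[OF d] by simp
  then have T: "T \<in> sets lborel" by (simp add: borel_compact)
  have "(\<Sum>k\<in>d. Sup k - Inf k) = (\<Sum>k\<in>d. measure lebesgue k)" by (simp add: eq)
  also have "\<dots> = measure lebesgue T" by (rule content_division[OF d])
  also have "\<dots> = measure lborel T" using T by (rule measure_completion)
  also have "\<dots> < e"
  proof -
    have "emeasure lborel T \<le> emeasure lborel U"
      using assms by (intro emeasure_mono) auto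
    with assms(4) have "emeasure lborel T < ennreal e" by simp
    then show ?thesis using e unfolding measure_def
      by (metis enn2real_nonneg ennreal_enn2real ennreal_less_iff order_less_trans ennreal_less_top)
  qed
  finally show ?thesis .
qed

text \<open>A gauge that is tied to the derivative off the exceptional null set, and to an open
  neighbourhood of small measure on it, splits the increment over a fine tagged division.\<close>

lemma absolutely_continuous_curve_nonincreasing:
  fixes f :: "real \<Rightarrow> real"
  assumes ac: "absolutely_continuous_curve {a..b} f" and ab: "a \<le> b"
    and der: "AE t in lborel. a < t \<longrightarrow> (\<exists>D\<le>0. (f has_real_derivative D) (at t))"
  shows "f b \<le> f a"
proof (rule field_le_epsilon)
  fix e :: real assume e: "0 < e"
  \<comment> \<open>Slope errors summed over length b - a stay below e / 2; the added 1 covers a =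
    b.\<close>
  define c where "c = e / (2 * (b - a + 1))"
  have c: "0 < c" using e ab by (simp add: c_def)
  obtain d where d: "0 < d" and D: "\<And>p T. p division_of T \<Longrightarrow> T \<subseteq> {a..b} \<Longrightarrow> (\<Sum>k\<in>p. Sup k - Inf k) < d \<Longrightarrow>
        (\<Sum>k\<in>p. dist (f (Sup k)) (f (Inf k))) < e / 2"
    using ac e unfolding absolutely_continuous_curve_def by (meson half_gt_zero)
  obtain N0 where N0: "{t \<in> space lborel. \<not> (a < t \<longrightarrow> (\<exists>D\<le>0. (f has_real_derivative D) (at t)))} \<subseteq> N0"
    "N0 \<in> null_sets lborel"
    using der by (auto elim!: AE_E intro: that)
  \<comment> \<open>A derivative is provided only for t > a, so the left end point joins the
    exceptional set.\<close>
  define N where "N = insert a N0"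
  have N: "N \<in> null_sets lborel" unfolding N_def using N0(2) by (metis insert_is_Un null_sets.Un finite.intros finite_imp_null_set_lborel)
  then have Nb: "N \<in> sets borel" by (auto simp: null_sets_def)
  obtain U where U: "open U" "N \<subseteq> U" "emeasure lborel (U - N) < ennreal d"
    using outer_regular_lborel[OF Nb] d by (metis ennreal_less_zero_iff)
  have "emeasure lborel U = emeasure lborel (U - N)"
    using N U(1) by (intro emeasure_Diff_null_set[symmetric]) auto
  with U(3) have Ud: "emeasure lborel U < ennreal d" by simp
  have "\<exists>r>0. \<forall>y. \<bar>y - x\<bar> < r \<longrightarrow>
      (if x \<in> N then y \<in> U else (x \<le> y \<longrightarrow> f y - f x \<le> c * (y - x)) \<and> (y \<le> x \<longrightarrow> f x - f y \<le> c * (x - y)))"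
    if x: "x \<in> {a..b}" for x
  proof (cases "x \<in> N")
    case True
    then obtain r where "0 < r" "ball x r \<subseteq> U" using U(1,2) by (meson open_contains_ball subsetD)
    then show ?thesis using True by (intro exI[of _ r]) (auto simp: subset_iff dist_real_def abs_minus_commute)
  next
    case False
    then obtain D where D: "D \<le> 0" "(f has_real_derivative D) (at x)"
      using N0(1) x by (auto simp: N_def order_le_less)
    then obtain r where r: "0 < r" "\<And>y. \<bar>y - x\<bar> < r \<Longrightarrow> \<bar>f y - f x - D * (y - x)\<bar> \<le> c * \<bar>y - x\<bar>"
      using c unfolding has_field_derivative_def has_derivative_at_alt real_norm_def by metis
    have "(x \<le> y \<longrightarrow> f y - f x \<le> c * (y - x)) \<and> (y \<le> x \<longrightarrow> f x - f y \<le> c * (x - y))"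
      if y: "\<bar>y - x\<bar> < r" for y
    proof (intro conjI impI)
      assume xy: "x \<le> y"
      then have "D * (y - x) \<le> 0" using D(1) by (simp add: mult_nonpos_nonneg)
      with r(2)[OF y] xy show "f y - f x \<le> c * (y - x)" by (simp add: abs_le_iff)
    next
      assume xy: "y \<le> x"
      then have "0 \<le> D * (y - x)" using D(1) by (simp add: mult_nonpos_nonpos)
      with r(2)[OF y] xy show "f x - f y \<le> c * (x - y)" by (simp add: abs_le_iff)
    qed
    with r(1) False show ?thesis by auto
  qed
  then obtain r where r: "\<And>x. x \<in> {a..b} \<Longrightarrow> 0 < r x"
    and R: "\<And>x y. x \<in> {a..b} \<Longrightarrow> \<bar>y - x\<bar> < r x \<Longrightarrow>
      (if x \<in> N then y \<in> U else (x \<le> y \<longrightarrow> f y - f x \<le> c * (y - x)) \<and> (y \<le> x \<longrightarrow> f x - f y \<le> c * (x - y)))"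
    by metis
  define g where "g x = (if x \<in> {a..b} then ball x (r x) else ball x 1)" for x
  have "gauge g" using r by (auto simp: gauge_def g_def)
  then obtain p where p: "p tagged_division_of {a..b}" "g fine p"
    by (rule fine_division_exists_real)
  have fin: "finite p" using p(1) by blast
  have tag: "x \<in> k" "\<exists>u v. u \<le> v \<and> k = {u..v}" "k \<subseteq> {a..b}" "\<forall>y\<in>k. \<bar>y - x\<bar> < r x"
    if xk: "(x, k) \<in> p" for x k
  proof -
    show xk': "x \<in> k" and kab: "k \<subseteq> {a..b}" using tagged_division_ofD(2,3)[OF p(1) xk] .
    show "\<exists>u v. u \<le> v \<and> k = {u..v}"
      using tagged_division_ofD(4)[OF p(1) xk] xk' by (metis atLeastatMost_empty_iff2 box_real(2) empty_iff)
    have "k \<subseteq> g x" using fineD[OF p(2) xk] .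
    with xk' kab show "\<forall>y\<in>k. \<bar>y - x\<bar> < r x" by (auto simp: g_def dist_real_def abs_minus_commute subset_iff)
  qed
  define q where "q = {z \<in> p. fst z \<in> N}"
  have incr: "(\<Sum>(x, k)\<in>p. f (Sup k) - f (Inf k)) = f b - f a"
    by (rule additive_tagged_division_1[OF ab p(1)])
  also have "(\<Sum>(x, k)\<in>p. f (Sup k) - f (Inf k))
      = (\<Sum>(x, k)\<in>q. f (Sup k) - f (Inf k)) + (\<Sum>(x, k)\<in>p - q. f (Sup k) - f (Inf k))"
    by (subst sum.subset_diff[of q p]) (auto simp: q_def fin add.commute)
  finally have split: "f b - f a = \<dots>" by simp
  have "(\<Sum>(x, k)\<in>p - q. f (Sup k) - f (Inf k)) \<le> (\<Sum>(x, k)\<in>p - q. c * (Sup k - Inf k))"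
  proof (rule sum_mono, clarify)
    fix x k assume xk: "(x, k) \<in> p" "(x, k) \<notin> q"
    then have xN: "x \<notin> N" by (simp add: q_def)
    obtain u v where uv: "u \<le> v" "k = {u..v}" using tag(2)[OF xk(1)] by auto
    have x: "u \<le> x" "x \<le> v" "x \<in> {a..b}" using tag(1,3)[OF xk(1)] uv by auto
    have uv': "\<bar>u - x\<bar> < r x" "\<bar>v - x\<bar> < r x" using tag(4)[OF xk(1)] uv by auto
    \<comment> \<open>The increment is split at the tag, because the derivative controls only
      differences taken from the tag.\<close>
    have "f v - f x \<le> c * (v - x)" "f x - f u \<le> c * (x - u)"
      using R[OF x(3) uv'(1)] R[OF x(3) uv'(2)] xN x by auto
    then show "f (Sup k) - f (Inf k) \<le> c * (Sup k - Inf k)"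
      using uv by (simp add: algebra_simps)
  qed
  also have "\<dots> \<le> (\<Sum>(x, k)\<in>p. c * (Sup k - Inf k))"
  proof (rule sum_mono2[OF fin])
    show "0 \<le> (case z of (x, k) \<Rightarrow> c * (Sup k - Inf k))" if "z \<in> p - (p - q)" for z
      using tag(2)[of "fst z" "snd z"] that c by (auto simp: case_prod_beta)
  qed auto
  also have "\<dots> = c * (b - a)"
    using additive_tagged_division_1[OF ab p(1), of "\<lambda>x. x"]
    by (simp add: case_prod_beta sum_distrib_left[symmetric])
  also have "\<dots> \<le> e / 2"
    using e ab by (simp add: c_def field_simps)
  finally have 1: "(\<Sum>(x, k)\<in>p - q. f (Sup k) - f (Inf k)) \<le> e / 2" .
  have 2: "(\<Sum>(x, k)\<in>q. f (Sup k) - f (Inf k)) \<le> e / 2"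
  proof -
    \<comment> \<open>Injectivity of \<open>snd\<close> is read off disjoint interiors, which say
      nothing about degenerate intervals; those have zero increment and are dropped.\<close>
    define q' where "q' = {z \<in> q. interior (snd z) \<noteq> {}}"
    have fq: "finite q" using fin by (simp add: q_def)
    have "(\<Sum>(x, k)\<in>q. f (Sup k) - f (Inf k)) = (\<Sum>(x, k)\<in>q'. f (Sup k) - f (Inf k))"
    proof (rule sum.mono_neutral_right[OF fq])
      show "\<forall>z\<in>q - q'. (case z of (x, k) \<Rightarrow> f (Sup k) - f (Inf k)) = 0"
      proof clarify
        fix x k assume xk: "(x, k) \<in> q" "(x, k) \<notin> q'"
        then have "(x, k) \<in> p" by (simp add: q_def)
        then obtain u v where uv: "u \<le> v" "k = {u..v}" using tag(2) by meson
        with xk have "interior {u..v} = {}" by (simp add: q'_def)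
        with uv show "f (Sup k) - f (Inf k) = 0" by (simp add: interior_atLeastAtMost_real)
      qed
    qed (auto simp: q'_def)
    also have "\<dots> = (\<Sum>k\<in>snd ` q'. f (Sup k) - f (Inf k))"
    proof (subst sum.reindex)
      show "inj_on snd q'"
      proof (rule inj_onI)
        fix y z assume yz: "y \<in> q'" "z \<in> q'" "snd y = snd z"
        show "y = z"
        proof (rule ccontr)
          assume "y \<noteq> z"
          then have "interior (snd y) \<inter> interior (snd z) = {}"
            using tagged_division_ofD(5)[OF p(1), of "fst y" "snd y" "fst z" "snd z"] yz(1,2)
            by (simp add: q'_def q_def)
          with yz show False by (auto simp: q'_def)
        qed
      qed
    qed (simp add: case_prod_beta)
    also have "\<dots> \<le> (\<Sum>k\<in>snd ` q'. dist (f (Sup k)) (f (Inf k)))"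
      by (intro sum_mono) (simp add: dist_real_def)
    also have "\<dots> < e / 2"
    proof (rule D)
      have "snd ` p division_of \<Union>(snd ` p)"
        using division_of_tagged_division[OF p(1)] division_ofD(6) by metis
      then show div: "snd ` q' division_of \<Union>(snd ` q')"
      proof (rule division_of_subset)
        show "snd ` q' \<subseteq> snd ` p" unfolding q'_def q_def by blast
      qed
      show "\<Union>(snd ` q') \<subseteq> {a..b}"
        using tag(3) by (fastforce simp: q'_def q_def)
      have "k \<subseteq> U" if xk: "(x, k) \<in> p" "x \<in> N" for x k
        using R tag(1,3,4)[OF xk(1)] xk(2) by (metis subset_iff)
      then have "\<Union>(snd ` q') \<subseteq> U" by (fastforce simp: q'_def q_def)
      then show "(\<Sum>k\<in>snd ` q'. Sup k - Inf k) < d"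
        by (rule sum_length_division_le_measure[OF div _ U(1) Ud])
    qed
    finally show ?thesis by simp
  qed
  show "f b \<le> f a + e" using split 1 2 by linarith
qed

text \<open>Where both curves are differentiable, half the derivative of the squared distance is <X
  - Y, D - E>, which monotonicity makes nonpositive.\<close>

lemma gradient_flow_nonexpansive:
  fixes X Y :: "real \<Rightarrow> 'a::real_inner"
  assumes mono: "\<And>x y v w. v \<in> subdifferential F x \<Longrightarrow> w \<in> subdifferential F y \<Longrightarrow> 0 \<le> inner (v - w) (x - y)"
    and X: "gradient_flow F X" and Y: "gradient_flow F Y" and t: "0 \<le> t"
  shows "norm (X t - Y t) \<le> norm (X 0 - Y 0)"
proof -
  have "(norm (X t - Y t))\<^sup>2 \<le> (norm (X 0 - Y 0))\<^sup>2"
  proof (rule absolutely_continuous_curve_nonincreasing[OF _ t])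
    show "absolutely_continuous_curve {0..t} (\<lambda>t. (norm (X t - Y t))\<^sup>2)"
      using X Y t by (intro absolutely_continuous_curve_norm_diff_square) (auto simp: gradient_flow_def)
    have "AE t in lborel. 0 < t \<longrightarrow> (\<exists>D. (X has_vector_derivative D) (at t) \<and> - D \<in> subdifferential F (X t))"
      "AE t in lborel. 0 < t \<longrightarrow> (\<exists>D. (Y has_vector_derivative D) (at t) \<and> - D \<in> subdifferential F (Y t))"
      using X Y by (auto simp: gradient_flow_def)
    then show "AE t in lborel. 0 < t \<longrightarrow> (\<exists>D\<le>0. ((\<lambda>t. (norm (X t - Y t))\<^sup>2) has_real_derivative D) (at t))"
    proof eventually_elim
      case (elim t)
      show ?case
      proof
        assume "0 < t"
        with elim obtain D E where D: "(X has_vector_derivative D) (at t)" "- D \<in> subdifferential F (X t)"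
          and E: "(Y has_vector_derivative E) (at t)" "- E \<in> subdifferential F (Y t)" by blast
        have "0 \<le> inner (- D - - E) (X t - Y t)" by (rule mono[OF D(2) E(2)])
        then have "2 * inner (X t - Y t) (D - E) \<le> 0"
          by (simp add: inner_diff_left inner_diff_right inner_commute)
        moreover have "((\<lambda>t. inner (X t - Y t) (X t - Y t)) has_derivative
            (\<lambda>h. inner (X t - Y t) (h *\<^sub>R D - h *\<^sub>R E) + inner (h *\<^sub>R D - h *\<^sub>R E) (X t - Y t))) (at t)"
          using D(1) E(1) unfolding has_vector_derivative_def by (intro derivative_intros)
        then have "((\<lambda>t. (norm (X t - Y t))\<^sup>2) has_real_derivative 2 * inner (X t - Y t) (D - E)) (at t)"
          unfolding has_field_derivative_def power2_norm_eq_inner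
          by (rule has_derivative_eq_rhs) (auto simp: inner_diff_right inner_diff_left inner_commute algebra_simps)
        ultimately show "\<exists>D\<le>0. ((\<lambda>t. (norm (X t - Y t))\<^sup>2) has_real_derivative D) (at t)" by blast
      qed
    qed
  qed
  then show ?thesis by (rule power2_le_imp_le) simp
qed

section \<open>Completeness of \<open>L\<^sup>2\<close> and the monotone cone\<close>

lemma space_Omega [simp]: "space Omega = {0<..<1}"
  by (simp add: Omega_def space_restrict_space)

lemma emeasure_Omega [simp]: "emeasure Omega {0<..<1} = 1"
  by (simp add: Omega_def emeasure_restrict_space space_restrict_space)

lemma measure_Omega [simp]: "measure Omega {0<..<1} = 1"
  by (simp add: measure_def)

lemma finite_measure_Omega: "finite_measure Omega"
  by (rule finite_measureI) simp

lemma integrable_const_Omega [simp]: "integrable Omega (\<lambda>_. c :: real)"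
  by (rule finite_measure.integrable_const[OF finite_measure_Omega])

lemma integral_const_Omega: "(\<integral>_. c \<partial>Omega) = (c :: real)"
  by simp

lemma AE_Omega: "(AE m in Omega. P m) \<longleftrightarrow> (AE m in lborel. 0 < m \<and> m < 1 \<longrightarrow> P m)"
  unfolding Omega_def by (subst AE_restrict_space_iff) auto

lemma square_integrable_measurable [measurable_dest]:
  "square_integrable f \<Longrightarrow> f \<in> borel_measurable Omega"
  by (simp add: square_integrable_def)

lemma square_integrable_const: "square_integrable (\<lambda>_. c)"
  by (simp add: square_integrable_def)

lemma square_integrable_diff:
  assumes "square_integrable f" "square_integrable g"
  shows "square_integrable (\<lambda>m. f m - g m)"
  using square_integrable_add[OF assms(1) square_integrable_scale[OF assms(2), of "-1"]] by simp

lemma square_integrable_abs: "square_integrable f \<Longrightarrow> square_integrable (\<lambda>m. \<bar>f m\<bar>)"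
  unfolding square_integrable_def by (auto intro: borel_measurable_abs)

lemma square_integrable_imp_integrable: "square_integrable f \<Longrightarrow> integrable Omega f"
  using square_integrable_mult[OF _ square_integrable_const[of 1], of f] by simp

lemma square_integrable_bound:
  assumes "square_integrable g" "f \<in> borel_measurable Omega" "\<And>m. \<bar>f m\<bar> \<le> \<bar>g m\<bar>"
  shows "square_integrable f"
  unfolding square_integrable_def
proof
  show "integrable Omega (\<lambda>m. (f m)\<^sup>2)"
  proof (rule Bochner_Integration.integrable_bound)
    show "integrable Omega (\<lambda>m. (g m)\<^sup>2)" using assms by (simp add: square_integrable_def)
    show "(\<lambda>m. (f m)\<^sup>2) \<in> borel_measurable Omega" using assms(2) by measurable
    show "AE m in Omega. norm ((f m)\<^sup>2) \<le> norm ((g m)\<^sup>2)"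
      using assms(3) by (simp add: abs_le_square_iff[symmetric])
  qed
qed (rule assms)

lemma square_integrable_rep [simp]: "square_integrable (rep_L2 X)"
  using l2_eq_rep_L2[of X] by (simp add: l2_eq_def)

lemma measurable_rep_L2 [measurable]: "rep_L2 X \<in> borel_measurable Omega"
  by (rule square_integrable_measurable) simp

lemma rep_abs_L2:
  assumes "square_integrable f"
  shows "AE m in Omega. rep_L2 (abs_L2 f) m = f m"
proof -
  have "l2_eq (rep_L2 (abs_L2 f)) f"
    by (rule rep_abs_rsp_left[OF Quotient3_L2]) (simp add: l2_eq_def assms)
  then show ?thesis by (simp add: l2_eq_def)
qed

lemma abs_L2_cong:
  assumes "square_integrable f" "square_integrable g" "AE m in Omega. f m = g m"
  shows "abs_L2 f = abs_L2 g"
  by (rule Quotient3_rel_abs[OF Quotient3_L2]) (simp add: l2_eq_def assms)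

lemma inner_abs_L2:
  "square_integrable f \<Longrightarrow> square_integrable g \<Longrightarrow> inner (abs_L2 f) (abs_L2 g) = (\<integral>m. f m * g m \<partial>Omega)"
  by (rule inner_L2.abs_eq) (simp_all add: l2_eq_def)

lemma abs_L2_add:
  "square_integrable f \<Longrightarrow> square_integrable g \<Longrightarrow> abs_L2 f + abs_L2 g = abs_L2 (\<lambda>m. f m + g m)"
  by (rule plus_L2.abs_eq) (simp_all add: l2_eq_def)

lemma abs_L2_scaleR: "square_integrable f \<Longrightarrow> c *\<^sub>R abs_L2 f = abs_L2 (\<lambda>m. c * f m)"
  by (rule scaleR_L2.abs_eq) (simp add: l2_eq_def)

lemma abs_L2_diff:
  assumes "square_integrable f" "square_integrable g"
  shows "abs_L2 f - abs_L2 g = abs_L2 (\<lambda>m. f m - g m)"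
proof -
  have "abs_L2 f - abs_L2 g = abs_L2 f + (-1) *\<^sub>R abs_L2 g" by simp
  also have "\<dots> = abs_L2 (\<lambda>m. f m - g m)"
    by (simp only: abs_L2_scaleR[OF assms(2)] abs_L2_add[OF assms(1) square_integrable_scale[OF assms(2)]]) simp
  finally show ?thesis .
qed

lemma diff_L2_eq: "X - Y = abs_L2 (\<lambda>m. rep_L2 X m - rep_L2 Y m)"
  using abs_L2_diff[of "rep_L2 X" "rep_L2 Y"] by (simp add: abs_L2_rep_L2)

lemma norm_abs_L2: "square_integrable f \<Longrightarrow> (norm (abs_L2 f))\<^sup>2 = (\<integral>m. (f m)\<^sup>2 \<partial>Omega)"
  unfolding power2_norm_eq_inner by (simp add: inner_abs_L2 power2_eq_square)

text \<open>Cauchy-Schwarz against the constant 1, whose norm is 1 because \<open>Omega\<close> has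
  total mass 1.\<close>

lemma integral_abs_le_norm:
  assumes "square_integrable f"
  shows "(\<integral>m. \<bar>f m\<bar> \<partial>Omega) \<le> norm (abs_L2 f)"
proof -
  have "(\<integral>m. \<bar>f m\<bar> * 1 \<partial>Omega) = inner (abs_L2 (\<lambda>m. \<bar>f m\<bar>)) (abs_L2 (\<lambda>_. 1))"
    by (rule inner_abs_L2[symmetric]) (intro square_integrable_abs square_integrable_const assms)+
  also have "\<dots> \<le> norm (abs_L2 (\<lambda>m. \<bar>f m\<bar>)) * norm (abs_L2 (\<lambda>_. 1))" by (rule norm_cauchy_schwarz)
  also have "norm (abs_L2 (\<lambda>_. 1)) = 1"
  proof (rule power2_eq_imp_eq)
    show "(norm (abs_L2 (\<lambda>_. 1)))\<^sup>2 = 1\<^sup>2"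
      by (simp only: norm_abs_L2[OF square_integrable_const] integral_const_Omega)
  qed simp_all
  also have "norm (abs_L2 (\<lambda>m. \<bar>f m\<bar>)) = norm (abs_L2 f)"
  proof (rule power2_eq_imp_eq)
    show "(norm (abs_L2 (\<lambda>m. \<bar>f m\<bar>)))\<^sup>2 = (norm (abs_L2 f))\<^sup>2"
      by (simp only: norm_abs_L2[OF square_integrable_abs[OF assms]] norm_abs_L2[OF assms] power2_abs)
  qed simp_all
  finally show ?thesis by simp
qed

text \<open>Riesz--Fischer for sequences that converge geometrically fast: summability of the increments
  in the \<open>L\<^sup>1\<close> norm yields convergence almost everywhere, and Fatou's lemma convergence in norm.\<close>

lemma L2_fast_Cauchy:
  fixes X :: "nat \<Rightarrow> L2"
  assumes fast: "\<And>n. norm (X (Suc n) - X n) \<le> (1/2) ^ n"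
  obtains g where "square_integrable g" "AE m in Omega. (\<lambda>n. rep_L2 (X n) m) \<longlonglongrightarrow> g m"
    "X \<longlonglongrightarrow> abs_L2 g"
proof -
  define f where "f n = rep_L2 (X n)" for n
  have fi: "square_integrable (f n)" for n by (simp add: f_def)
  have fm [measurable]: "f n \<in> borel_measurable Omega" for n by (simp add: f_def)
  define d where "d n m = \<bar>f (Suc n) m - f n m\<bar>" for n m
  have dm [measurable]: "d n \<in> borel_measurable Omega" for n unfolding d_def by measurable
  have dint: "(\<integral>\<^sup>+m. ennreal (d n m) \<partial>Omega) \<le> ennreal ((1/2) ^ n)" for n
  proof -
    have "(\<integral>\<^sup>+m. ennreal (d n m) \<partial>Omega) = ennreal (\<integral>m. d n m \<partial>Omega)"
      unfolding d_def
      by (intro nn_integral_eq_integral square_integrable_imp_integrable square_integrable_abs square_integrable_diff fi) simp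
    also have "(\<integral>m. d n m \<partial>Omega) \<le> norm (X (Suc n) - X n)"
      unfolding d_def diff_L2_eq[of "X (Suc n)"] f_def
      by (intro integral_abs_le_norm square_integrable_diff) auto
    finally show ?thesis using fast[of n] by (meson ennreal_leI order_trans)
  qed
  have "(\<integral>\<^sup>+m. (\<Sum>n. ennreal (d n m)) \<partial>Omega) = (\<Sum>n. \<integral>\<^sup>+m. ennreal (d n m) \<partial>Omega)"
    by (rule nn_integral_suminf) simp
  also have "\<dots> \<le> (\<Sum>n. ennreal ((1/2) ^ n))" by (intro suminf_le dint) auto
  also have "\<dots> = ennreal (\<Sum>n. (1/2) ^ n)" by (rule suminf_ennreal2) (auto intro: summable_geometric)
  also have "\<dots> < \<infinity>" by simp
  finally have "AE m in Omega. (\<Sum>n. ennreal (d n m)) \<noteq> \<infinity>"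
    by (intro nn_integral_PInf_AE) auto
  then have AEc: "AE m in Omega. convergent (\<lambda>n. f n m)"
  proof eventually_elim
    case (elim m)
    then have "summable (\<lambda>n. d n m)"
      by (intro summable_suminf_not_top) (auto simp: d_def)
    then have "summable (\<lambda>n. f (Suc n) m - f n m)"
      unfolding d_def by (rule summable_rabs_cancel)
    then have "convergent (\<lambda>n. \<Sum>i<n. f (Suc i) m - f i m)"
      by (simp add: summable_iff_convergent)
    then have "convergent (\<lambda>n. f n m - f 0 m)"
      by (subst (asm) sum_lessThan_telescope)
    from convergent_add[OF this convergent_const[of "f 0 m"]] show ?case by simp
  qed
  define g where "g m = lim (\<lambda>n. f n m)" for m
  have gm [measurable]: "g \<in> borel_measurable Omega" unfolding g_def by measurable
  have AEg: "AE m in Omega. (\<lambda>n. f n m) \<longlonglongrightarrow> g m"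
    using AEc by eventually_elim (simp add: g_def convergent_LIMSEQ_iff)
  \<comment> \<open>The subtracted term lets the induction close: adding (1/2)^(n+k) to the bound
    gives exactly the next one.\<close>
  have tail: "norm (X (n + k) - X n) \<le> 2 * (1/2) ^ n - 2 * (1/2) ^ (n + k)" for n k
  proof (induction k)
    case (Suc k)
    have "norm (X (n + Suc k) - X n) \<le> norm (X (Suc (n + k)) - X (n + k)) + norm (X (n + k) - X n)"
      using norm_triangle_ineq[of "X (Suc (n + k)) - X (n + k)" "X (n + k) - X n"] by simp
    also have "\<dots> \<le> (1/2) ^ (n + k) + (2 * (1/2) ^ n - 2 * (1/2) ^ (n + k))"
      by (intro add_mono fast Suc)
    finally show ?case by simp
  qed simp
  have fatou: "(\<integral>\<^sup>+m. ennreal ((g m - f n m)\<^sup>2) \<partial>Omega) \<le> ennreal ((2 * (1/2) ^ n)\<^sup>2)" for n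
  proof -
    have "(\<integral>\<^sup>+m. ennreal ((g m - f n m)\<^sup>2) \<partial>Omega)
        = (\<integral>\<^sup>+m. liminf (\<lambda>k. ennreal ((f k m - f n m)\<^sup>2)) \<partial>Omega)"
      using AEg
    proof (intro nn_integral_cong_AE, eventually_elim)
      case (elim m)
      have "(\<lambda>k. ennreal ((f k m - f n m)\<^sup>2)) \<longlonglongrightarrow> ennreal ((g m - f n m)\<^sup>2)"
        by (intro tendsto_ennrealI tendsto_intros elim)
      then show ?case by (intro lim_imp_Liminf[symmetric]) simp_all
    qed
    also have "\<dots> \<le> liminf (\<lambda>k. \<integral>\<^sup>+m. ennreal ((f k m - f n m)\<^sup>2) \<partial>Omega)"
      by (rule nn_integral_liminf) simp
    also have "\<dots> \<le> limsup (\<lambda>k. \<integral>\<^sup>+m. ennreal ((f k m - f n m)\<^sup>2) \<partial>Omega)"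
      by (rule Liminf_le_Limsup) simp
    also have "\<dots> \<le> ennreal ((2 * (1/2) ^ n)\<^sup>2)"
    proof (rule Limsup_bounded, rule eventually_sequentiallyI[of n])
      fix k assume "n \<le> k"
      have si: "square_integrable (\<lambda>m. f k m - f n m)" by (intro square_integrable_diff fi)
      have "(\<integral>\<^sup>+m. ennreal ((f k m - f n m)\<^sup>2) \<partial>Omega) = ennreal (\<integral>m. (f k m - f n m)\<^sup>2 \<partial>Omega)"
        using si by (intro nn_integral_eq_integral) (auto simp: square_integrable_def)
      also have "(\<integral>m. (f k m - f n m)\<^sup>2 \<partial>Omega) = (norm (X k - X n))\<^sup>2"
        using norm_abs_L2[OF si] unfolding diff_L2_eq[of "X k"] f_def by simp
      also have "\<dots> \<le> (2 * (1/2) ^ n)\<^sup>2"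
      proof (rule power_mono)
        have "0 \<le> (2 :: real) * (1/2) ^ (n + (k - n))" by simp
        with tail[of n "k - n"] have "norm (X (n + (k - n)) - X n) \<le> 2 * (1/2) ^ n" by linarith
        with \<open>n \<le> k\<close> show "norm (X k - X n) \<le> 2 * (1/2) ^ n" by simp
      qed simp
      finally show "(\<integral>\<^sup>+m. ennreal ((f k m - f n m)\<^sup>2) \<partial>Omega) \<le> ennreal ((2 * (1/2) ^ n)\<^sup>2)"
        by (simp add: ennreal_leI)
    qed
    finally show ?thesis .
  qed
  have gf: "square_integrable (\<lambda>m. g m - f n m)" for n
    unfolding square_integrable_def
  proof
    show "integrable Omega (\<lambda>m. (g m - f n m)\<^sup>2)"
      using order_le_less_trans[OF fatou[of n] ennreal_less_top]
      by (intro integrableI_bounded) auto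
  qed measurable
  have g: "square_integrable g"
    using square_integrable_add[OF gf[of 0] fi[of 0]] by simp
  have "(\<lambda>n. abs_L2 g - X n) \<longlonglongrightarrow> 0"
  proof (rule Lim_null_comparison)
    have "norm (abs_L2 g - X n) \<le> 2 * (1/2) ^ n" for n
    proof (rule power2_le_imp_le)
      have "abs_L2 g - X n = abs_L2 (\<lambda>m. g m - f n m)"
        using abs_L2_diff[OF g fi, of n] by (simp add: f_def abs_L2_rep_L2)
      then have "ennreal ((norm (abs_L2 g - X n))\<^sup>2) = (\<integral>\<^sup>+m. ennreal ((g m - f n m)\<^sup>2) \<partial>Omega)"
        using gf[of n] norm_abs_L2[OF gf[of n]]
        by (subst nn_integral_eq_integral) (auto simp: square_integrable_def)
      with fatou[of n] have "ennreal ((norm (abs_L2 g - X n))\<^sup>2) \<le> ennreal ((2 * (1/2) ^ n)\<^sup>2)"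
        by (simp only:)
      then show "(norm (abs_L2 g - X n))\<^sup>2 \<le> (2 * (1/2) ^ n)\<^sup>2"
        by (subst (asm) ennreal_le_iff) auto
    qed simp
    then show "\<forall>\<^sub>F n in sequentially. norm (abs_L2 g - X n) \<le> 2 * (1/2) ^ n" by simp
    show "(\<lambda>n. 2 * (1/2) ^ n :: real) \<longlonglongrightarrow> 0"
      by (intro tendsto_mult_right_zero LIMSEQ_power_zero) simp
  qed
  then have "(\<lambda>n. abs_L2 g - (abs_L2 g - X n)) \<longlonglongrightarrow> abs_L2 g - 0"
    by (intro tendsto_intros)
  then have "X \<longlonglongrightarrow> abs_L2 g" by simp
  with g AEg show ?thesis using that unfolding f_def by blast
qed

lemma Cauchy_fast_subseq:
  fixes X :: "nat \<Rightarrow> 'a::metric_space"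
  assumes "Cauchy X"
  obtains r where "strict_mono r" "\<And>n. dist (X (r (Suc n))) (X (r n)) \<le> (1/2) ^ n"
proof -
  have "\<exists>N. \<forall>i\<ge>N. \<forall>j\<ge>N. dist (X i) (X j) < (1/2) ^ n" for n
    using assms by (auto simp: Cauchy_def)
  then obtain N where N: "\<And>n i j. N n \<le> i \<Longrightarrow> N n \<le> j \<Longrightarrow> dist (X i) (X j) < (1/2) ^ n" by metis
  have "\<exists>r. \<forall>n. N n \<le> r n \<and> r n < r (Suc n)"
  proof (rule dependent_nat_choice)
    show "\<exists>k. N 0 \<le> k" by blast
    show "\<exists>l. N (Suc n) \<le> l \<and> k < l" for k n
      by (rule exI[of _ "max (N (Suc n)) (Suc k)"]) auto
  qed
  then obtain r where r: "\<And>n. N n \<le> r n" "\<And>n. r n < r (Suc n)" by blast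
  then have "dist (X (r (Suc n))) (X (r n)) \<le> (1/2) ^ n" for n
    by (meson N less_imp_le order_trans)
  with r(2) show ?thesis by (intro that[of r]) (auto simp: strict_mono_Suc_iff)
qed

text \<open>Completeness is what resolvent limits and proximal points require of the space. A fast
  subsequence converges, and a Cauchy sequence follows any convergent subsequence.\<close>

instance L2 :: complete_space
proof
  fix X :: "nat \<Rightarrow> L2" assume X: "Cauchy X"
  then obtain r where r: "strict_mono r" "\<And>n. dist (X (r (Suc n))) (X (r n)) \<le> (1/2) ^ n"
    by (rule Cauchy_fast_subseq) blast
  have "norm (X (r (Suc n)) - X (r n)) \<le> (1/2) ^ n" for n
    using r(2) by (simp add: dist_norm)
  then obtain g where "(\<lambda>n. X (r n)) \<longlonglongrightarrow> abs_L2 g"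
    by (rule L2_fast_Cauchy)
  then obtain l where l: "(X \<circ> r) \<longlonglongrightarrow> l" by (auto simp: o_def)
  have "X \<longlonglongrightarrow> l"
  proof (rule metric_LIMSEQ_I)
    fix e :: real assume e: "0 < e"
    obtain M where M: "\<And>i j. M \<le> i \<Longrightarrow> M \<le> j \<Longrightarrow> dist (X i) (X j) < e / 2"
      using metric_CauchyD[OF X, of "e / 2"] e by auto
    obtain M' where M': "\<And>i. M' \<le> i \<Longrightarrow> dist (X (r i)) l < e / 2"
      using metric_LIMSEQ_D[OF l, of "e / 2"] e by auto
    have "dist (X n) l < e" if "M \<le> n" for n
    proof -
      let ?k = "max n M'"
      have "n \<le> r ?k" using seq_suble[OF r(1), of ?k] by simp
      then have "dist (X n) (X (r ?k)) < e / 2" using that by (intro M) auto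
      moreover have "dist (X (r ?k)) l < e / 2" by (rule M') simp
      ultimately show ?thesis using dist_triangle[of "X n" l "X (r ?k)"] by simp
    qed
    then show "\<exists>N. \<forall>n\<ge>N. dist (X n) l < e" by blast
  qed
  then show "convergent X" by (auto simp: convergent_def)
qed

text \<open>The representative is the right limit of the values on the full-measure set; it can differ from
  them only where it is discontinuous.\<close>

lemma AE_mono_right_continuous_version:
  fixes g :: "real \<Rightarrow> real"
  assumes mono: "mono_on S g" and S: "AE m in Omega. m \<in> S"
  obtains f where "mono_on {0<..<1} f" "\<forall>m\<in>{0<..<1}. continuous (at_right m) f"
    "AE m in Omega. f m = g m"
proof -
  define E where "E = S \<inter> {0<..<1}"
  \<comment> \<open>A set of full measure meets every interval, so right limits can be taken along
    it.\<close>
  have dense: "\<exists>x\<in>E. a < x \<and> x < b" if ab: "0 \<le> a" "a < b" "b \<le> 1" for a b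
  proof (rule ccontr)
    assume contra: "\<not> ?thesis"
    have "AE x in lborel. x \<notin> {a<..<b}"
      using S unfolding AE_Omega
    proof eventually_elim
      case (elim x)
      show ?case
      proof
        assume x: "x \<in> {a<..<b}"
        with ab elim have "x \<in> E" by (simp add: E_def)
        with x contra show False by auto
      qed
    qed
    then have "{a<..<b} \<in> null_sets lborel"
      by (subst AE_iff_null_sets) auto
    with ab show False by (simp add: null_sets_def)
  qed
  \<comment> \<open>The infimum runs over points strictly to the right of m; including m itself
    would spoil right continuity at jumps of \<open>g\<close>.\<close>
  define f where "f m = Inf (g ` (E \<inter> {m<..}))" for m
  have gmono: "g x \<le> g y" if "x \<in> E" "y \<in> E" "x \<le> y" for x y
    using mono_onD[OF mono, of x y] that by (auto simp: E_def)
  have bdd: "bdd_below (g ` (E \<inter> {m<..}))" and ne: "E \<inter> {m<..} \<noteq> {}" if m: "0 < m" "m < 1" for m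
  proof -
    obtain x where "x \<in> E" "x < m" using dense[of 0 m] m by auto
    then show "bdd_below (g ` (E \<inter> {m<..}))"
      by (intro bdd_belowI2[of _ "g x"] gmono) auto
    show "E \<inter> {m<..} \<noteq> {}" using dense[of m 1] m by auto
  qed
  have f_le: "f m \<le> g x" if "0 < m" "x \<in> E" "m < x" for m x
    unfolding f_def using that by (intro cINF_lower bdd) (auto simp: E_def)
  have f_ge: "g x \<le> f m" if "0 < m" "m < 1" "x \<in> E" "x \<le> m" for m x
    unfolding f_def using that by (intro cINF_greatest ne gmono) auto
  have fmono: "mono_on {0<..<1} f"
  proof (rule mono_onI)
    fix x y :: real assume xy: "x \<in> {0<..<1}" "y \<in> {0<..<1}" "x \<le> y"
    show "f x \<le> f y"
      unfolding f_def[of y] using xy by (intro cINF_greatest ne f_le) auto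
  qed
  have fcont: "continuous (at_right m) f" if m: "m \<in> {0<..<1}" for m
    unfolding continuous_within_eps_delta
  proof (intro allI impI)
    fix e :: real assume e: "0 < e"
    have "\<exists>x\<in>E \<inter> {m<..}. g x < f m + e"
      using cINF_less_iff[of "E \<inter> {m<..}" g "f m + e"] ne[of m] bdd[of m] m e by (simp add: f_def)
    then obtain x where x: "x \<in> E" "m < x" "g x < f m + e" by auto
    have "dist (f y) (f m) < e" if y: "y \<in> {m<..}" "dist y m < x - m" for y
    proof -
      have "m < y" "y < x" using y by (auto simp: dist_real_def)
      then have "f y \<le> g x" "f m \<le> f y"
        using f_le[of y x] mono_onD[OF fmono, of m y] m x by (auto simp: E_def)
      with x show ?thesis by (simp add: dist_real_def)
    qed
    then show "\<exists>d>0. \<forall>x'\<in>{m<..}. dist x' m < d \<longrightarrow> dist (f x') (f m) < e"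
      using x by (intro exI[of _ "x - m"]) auto
  qed
  have "countable {m \<in> {0<..<1}. \<not> isCont f m}"
    by (rule mono_on_ctble_discont_open[OF _ fmono]) simp
  then have "AE m in lborel. m \<notin> {m \<in> {0<..<1}. \<not> isCont f m}"
    by (intro AE_not_in countable_imp_null_set_lborel)
  with S[unfolded AE_Omega] have "AE m in lborel. 0 < m \<and> m < 1 \<longrightarrow> f m = g m"
  proof eventually_elim
    case (elim m)
    show ?case
    proof
      assume m: "0 < m \<and> m < 1"
      with elim have mE: "m \<in> E" and cont: "isCont f m" by (auto simp: E_def)
      \<comment> \<open>At a continuity point \<open>f m\<close> is approached by values
        \<open>f y\<close> with y < m, and each of these is at most \<open>g m\<close>.\<close>
      have "f m \<le> g m"
      proof (rule field_le_epsilon)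
        fix e :: real assume e: "0 < e"
        obtain d where d: "0 < d" "\<And>y. dist y m < d \<Longrightarrow> dist (f y) (f m) < e"
          using cont e unfolding continuous_at_eps_delta by blast
        define y where "y = max (m / 2) (m - d / 2)"
        have y: "0 < y" "y < m" "dist y m < d" using m d by (auto simp: y_def dist_real_def max_def)
        have "f y \<le> g m" by (rule f_le[OF y(1) mE y(2)])
        moreover have "f m < f y + e" using d(2)[OF y(3)] by (auto simp: dist_real_def)
        ultimately show "f m \<le> g m + e" by simp
      qed
      with f_ge[of m m] mE m show "f m = g m" by simp
    qed
  qed
  then have "AE m in Omega. f m = g m" by (simp add: AE_Omega)
  with fmono fcont that show ?thesis by blast
qed

text \<open>Along a fast subsequence the monotone representatives converge almost everywhere, so the
  limit is monotone on a set of full measure. Right continuity is not inherited by such limits and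
  is restored by changing the representative.\<close>

lemma closed_monotone_cone: "closed monotone_cone"
  unfolding closed_sequential_limits
proof (intro allI impI, elim conjE)
  fix X l assume K: "\<forall>n. X n \<in> monotone_cone" and l: "X \<longlonglongrightarrow> l"
  obtain r where r: "strict_mono r" "\<And>n. dist (X (r (Suc n))) (X (r n)) \<le> (1/2) ^ n"
    using Cauchy_fast_subseq[OF LIMSEQ_imp_Cauchy[OF l]] by blast
  have "norm (X (r (Suc n)) - X (r n)) \<le> (1/2) ^ n" for n
    using r(2) by (simp add: dist_norm)
  then obtain g where g: "square_integrable g" "AE m in Omega. (\<lambda>n. rep_L2 (X (r n)) m) \<longlonglongrightarrow> g m"
    "(\<lambda>n. X (r n)) \<longlonglongrightarrow> abs_L2 g"
    by (rule L2_fast_Cauchy) blast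
  have lg: "l = abs_L2 g"
    using LIMSEQ_subseq_LIMSEQ[OF l r(1)] g(3) by (auto simp: o_def intro: LIMSEQ_unique)
  obtain f where f: "\<And>n. square_integrable (f n)" "\<And>n. mono_on {0<..<1} (f n)" "\<And>n. X (r n) = abs_L2 (f n)"
  proof -
    have "\<exists>f. square_integrable f \<and> mono_on {0<..<1} f \<and> X (r n) = abs_L2 f" for n
    proof -
      have "X (r n) \<in> monotone_cone" using K by blast
      then show ?thesis unfolding monotone_cone_def by blast
    qed
    then show ?thesis using that by metis
  qed
  \<comment> \<open>Chosen and monotone representatives differ on a null set that depends on n;
    countably many are discarded at once.\<close>
  have "AE m in Omega. \<forall>n. rep_L2 (X (r n)) m = f n m"
    unfolding AE_all_countable f(3) by (intro allI rep_abs_L2 f)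
  with g(2) have "AE m in Omega. (\<lambda>n. f n m) \<longlonglongrightarrow> g m"
    by eventually_elim auto
  with AE_space have S: "AE m in Omega. m \<in> {m \<in> {0<..<1}. (\<lambda>n. f n m) \<longlonglongrightarrow> g m}"
    by eventually_elim auto
  have "mono_on {m \<in> {0<..<1}. (\<lambda>n. f n m) \<longlonglongrightarrow> g m} g"
  proof (rule mono_onI)
    fix x y assume xy: "x \<in> {m \<in> {0<..<1}. (\<lambda>n. f n m) \<longlonglongrightarrow> g m}"
      "y \<in> {m \<in> {0<..<1}. (\<lambda>n. f n m) \<longlonglongrightarrow> g m}" "x \<le> y"
    then show "g x \<le> g y"
      using f(2) by (intro LIMSEQ_le[of "\<lambda>n. f n x" _ "\<lambda>n. f n y"]) (auto simp: mono_on_def)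
  qed
  then obtain h where h: "mono_on {0<..<1} h" "\<forall>m\<in>{0<..<1}. continuous (at_right m) h" "AE m in Omega. h m = g m"
    using AE_mono_right_continuous_version[OF _ S] by blast
  have hm: "h \<in> borel_measurable Omega"
  proof -
    have "sets Omega = sets (restrict_space borel {0<..<1})"
      unfolding Omega_def by (simp add: sets_restrict_space)
    from measurable_cong_sets[OF this refl] show ?thesis
      using borel_measurable_mono_on_fnc[OF h(1)] by blast
  qed
  have "integrable Omega (\<lambda>m. (h m)\<^sup>2) \<longleftrightarrow> integrable Omega (\<lambda>m. (g m)\<^sup>2)"
    using h(3) hm g(1) by (intro integrable_cong_AE) auto
  then have hs: "square_integrable h" using hm g(1) by (simp add: square_integrable_def)
  have "l = abs_L2 h"
    unfolding lg using h(3) by (intro abs_L2_cong g hs) auto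
  with hs h show "l \<in> monotone_cone" unfolding monotone_cone_def by blast
qed

lemma convex_monotone_cone: "convex monotone_cone"
proof (rule convexI)
  fix X Y and u v :: real
  assume "X \<in> monotone_cone" "Y \<in> monotone_cone" and uv: "0 \<le> u" "0 \<le> v" "u + v = 1"
  then obtain f g where f: "X = abs_L2 f" "square_integrable f" "mono_on {0<..<1} f" "\<forall>m\<in>{0<..<1}. continuous (at_right m) f"
    and g: "Y = abs_L2 g" "square_integrable g" "mono_on {0<..<1} g" "\<forall>m\<in>{0<..<1}. continuous (at_right m) g"
    unfolding monotone_cone_def by auto
  have "u *\<^sub>R X + v *\<^sub>R Y = abs_L2 (\<lambda>m. u * f m + v * g m)"
    unfolding f(1) g(1) by (simp add: abs_L2_scaleR abs_L2_add square_integrable_scale f(2) g(2))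
  moreover have "square_integrable (\<lambda>m. u * f m + v * g m)"
    by (intro square_integrable_add square_integrable_scale f g)
  moreover have "mono_on {0<..<1} (\<lambda>m. u * f m + v * g m)"
    using f(3) g(3) uv by (auto simp: mono_on_def intro!: add_mono mult_left_mono)
  moreover have "\<forall>m\<in>{0<..<1}. continuous (at_right m) (\<lambda>m. u * f m + v * g m)"
    using f(4) g(4) by (auto intro!: continuous_intros)
  ultimately show "u *\<^sub>R X + v *\<^sub>R Y \<in> monotone_cone"
    unfolding monotone_cone_def by blast
qed

section \<open>Subgradients of the interaction energy\<close>

lemma Phi_diff:
  assumes "communication_protocol \<phi>"
  shows "Phi \<phi> b - Phi \<phi> a = (LBINT y=a..b. \<phi> y)"
proof -
  have int: "interval_lebesgue_integrable lborel (ereal u) (ereal v) \<phi>" for u v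
  proof -
    have "set_integrable lborel {min u v..max u v} \<phi>"
      using assms by (simp add: communication_protocol_def)
    then have "set_integrable lborel {u<..<v} \<phi>" "set_integrable lborel {v<..<u} \<phi>"
      by (auto elim!: set_integrable_subset)
    then show ?thesis by (simp add: interval_lebesgue_integrable_def)
  qed
  have "(LBINT y=ereal 0..ereal a. \<phi> y) + (LBINT y=ereal a..ereal b. \<phi> y) = (LBINT y=ereal 0..ereal b. \<phi> y)"
    by (rule interval_integral_sum) (simp only: ereal_min[symmetric] ereal_max[symmetric] int)
  then show ?thesis by (simp add: Phi_def zero_ereal_def)
qed

lemma Phi_mono:
  assumes \<phi>: "communication_protocol \<phi>"
  shows "mono (Phi \<phi>)"
proof (rule monoI)
  fix a b :: real assume ab: "a \<le> b"
  have "0 \<le> (LBINT y:{a..b}. \<phi> y)"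
    unfolding set_lebesgue_integral_def
    using \<phi> by (intro integral_nonneg_AE) (auto simp: communication_protocol_def indicator_def)
  then show "Phi \<phi> a \<le> Phi \<phi> b"
    using Phi_diff[OF \<phi>, of b a] ab by (simp add: interval_integral_Icc)
qed

lemma Phi_0 [simp]: "Phi \<phi> 0 = 0"
  by (simp add: Phi_def zero_ereal_def[symmetric])

lemma Phi_minus:
  assumes "communication_protocol \<phi>"
  shows "Phi \<phi> (- x) = - Phi \<phi> x"
proof -
  have "Phi \<phi> (- x) = (LBINT y=ereal x..0. \<phi> (- y))"
    unfolding Phi_def by (subst interval_integral_reflect) simp
  also have "\<dots> = (LBINT y=ereal x..0. \<phi> y)"
    using assms by (simp add: communication_protocol_def)
  also have "\<dots> = - Phi \<phi> x"
    unfolding Phi_def by (rule interval_integral_endpoints_reverse)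
  finally show ?thesis .
qed

text \<open>Beyond 1 the protocol is at most \<open>\<phi> 1\<close>, and a singularity at the
  origin contributes only the finite amount \<open>Phi \<phi> 1\<close>; oddness covers negative
  arguments.\<close>

lemma Phi_linear_growth:
  assumes \<phi>: "communication_protocol \<phi>"
  obtains C where "0 \<le> C" "\<And>x. \<bar>Phi \<phi> x\<bar> \<le> C * (1 + \<bar>x\<bar>)"
proof
  have \<phi>0: "0 \<le> \<phi> 1" using \<phi> by (simp add: communication_protocol_def)
  have P1: "0 \<le> Phi \<phi> 1" using monoD[OF Phi_mono[OF \<phi>], of 0 1] by simp
  show "0 \<le> Phi \<phi> 1 + \<phi> 1" using \<phi>0 P1 by simp
  have pos: "\<bar>Phi \<phi> x\<bar> \<le> (Phi \<phi> 1 + \<phi> 1) * (1 + \<bar>x\<bar>)" if x: "0 \<le> x" for x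
  proof -
    have x0: "0 \<le> Phi \<phi> x" using monoD[OF Phi_mono[OF \<phi>] x] by simp
    have "Phi \<phi> x \<le> Phi \<phi> 1 + \<phi> 1 * x"
    proof (cases "x \<le> 1")
      case True
      then show ?thesis using monoD[OF Phi_mono[OF \<phi>] True] \<phi>0 x by (simp add: add_increasing2)
    next
      case False
      have "(LBINT y:{1..x}. \<phi> y) \<le> (LBINT y:{1..x}. \<phi> 1)"
      proof (rule set_integral_mono)
        show "set_integrable lborel {1..x} \<phi>" using \<phi> by (simp add: communication_protocol_def)
        show "set_integrable lborel {1..x} (\<lambda>_. \<phi> 1)" using False by (simp add: set_integrable_def)
        show "\<phi> y \<le> \<phi> 1" if "y \<in> {1..x}" for y
          using \<phi> that by (auto simp: communication_protocol_def dest: monotone_onD[of _ _ _ _ 1 y])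
      qed
      also have "\<dots> = \<phi> 1 * (x - 1)"
        using False by (simp add: set_lebesgue_integral_def mult.commute)
      finally show ?thesis
        using Phi_diff[OF \<phi>, of x 1] False \<phi>0 by (simp add: interval_integral_Icc algebra_simps)
    qed
    also have "\<dots> \<le> (Phi \<phi> 1 + \<phi> 1) * (1 + \<bar>x\<bar>)"
      using x \<phi>0 P1 by (simp add: algebra_simps)
    finally show ?thesis using x0 by simp
  qed
  fix x
  show "\<bar>Phi \<phi> x\<bar> \<le> (Phi \<phi> 1 + \<phi> 1) * (1 + \<bar>x\<bar>)"
    using pos[of x] pos[of "- x"] Phi_minus[OF \<phi>, of x] by (cases "0 \<le> x") auto
qed

text \<open>Between \<open>a\<close> and \<open>b\<close> the nondecreasing \<open>Phi\<close> is
  compared with its value at \<open>a\<close>; the orientation of the integral yields the same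
  inequality for both signs of b - a.\<close>

lemma W_Phi_subgradient:
  assumes \<phi>: "communication_protocol \<phi>"
  shows "Phi \<phi> a * (b - a) \<le> W_Phi \<phi> b - W_Phi \<phi> a"
proof -
  have [measurable]: "Phi \<phi> \<in> borel_measurable borel"
    by (rule borel_measurable_mono[OF Phi_mono[OF \<phi>]])
  have set_int: "set_integrable lborel {u..v} (Phi \<phi>)" for u v
    unfolding set_integrable_def
  proof (rule integrableI_bounded_set_indicator[where B = "\<bar>Phi \<phi> u\<bar> + \<bar>Phi \<phi> v\<bar>"])
    have "norm (Phi \<phi> x) \<le> \<bar>Phi \<phi> u\<bar> + \<bar>Phi \<phi> v\<bar>" if "x \<in> {u..v}" for x
      using monoD[OF Phi_mono[OF \<phi>], of u x] monoD[OF Phi_mono[OF \<phi>], of x v] that by auto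
    then show "AE x in lborel. x \<in> {u..v} \<longrightarrow> norm (Phi \<phi> x) \<le> \<bar>Phi \<phi> u\<bar> + \<bar>Phi \<phi> v\<bar>" by simp
  qed (auto simp: emeasure_lborel_Icc_eq)
  have int: "interval_lebesgue_integrable lborel (ereal u) (ereal v) (Phi \<phi>)" for u v
  proof -
    have "set_integrable lborel {u<..<v} (Phi \<phi>)" "set_integrable lborel {v<..<u} (Phi \<phi>)"
      by (rule set_integrable_subset[OF set_int[of "min u v" "max u v"]]; auto)+
    then show ?thesis by (simp add: interval_lebesgue_integrable_def)
  qed
  have diff: "W_Phi \<phi> v - W_Phi \<phi> u = (LBINT y=u..v. Phi \<phi> y)" for u v
  proof -
    have "(LBINT y=ereal 0..ereal u. Phi \<phi> y) + (LBINT y=ereal u..ereal v. Phi \<phi> y) = (LBINT y=ereal 0..ereal v. Phi \<phi> y)"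
      by (rule interval_integral_sum) (simp only: ereal_min[symmetric] ereal_max[symmetric] int)
    then show ?thesis by (simp add: W_Phi_def zero_ereal_def)
  qed
  have const: "set_integrable lborel {u..v} (\<lambda>_. c)" "(LBINT y:{u..v}. c) = c * (v - u)"
    if "u \<le> v" for u v c :: real
    using that by (simp_all add: set_integrable_def set_lebesgue_integral_def mult.commute)
  show ?thesis
  proof (cases "a \<le> b")
    case True
    have "(LBINT y:{a..b}. Phi \<phi> a) \<le> (LBINT y:{a..b}. Phi \<phi> y)"
      using True by (intro set_integral_mono set_int const monoD[OF Phi_mono[OF \<phi>]]) auto
    then show ?thesis using diff[of b a] True const[OF True] by (simp add: interval_integral_Icc)
  next
    case False
    have "(LBINT y:{b..a}. Phi \<phi> y) \<le> (LBINT y:{b..a}. Phi \<phi> a)"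
      using False by (intro set_integral_mono set_int const monoD[OF Phi_mono[OF \<phi>]]) auto
    then show ?thesis using diff[of a b] False const[of b a] by (simp add: interval_integral_Icc algebra_simps)
  qed
qed

text \<open>The subgradient inequality gives convexity, and a finite convex function on the line is
  continuous.\<close>

lemma W_Phi_measurable:
  assumes \<phi>: "communication_protocol \<phi>"
  shows "W_Phi \<phi> \<in> borel_measurable borel"
proof (rule borel_measurable_continuous_onI)
  have "convex_on UNIV (W_Phi \<phi>)"
  proof (rule convex_onI)
    fix t x y :: real assume t: "0 < t" "t < 1"
    let ?p = "(1 - t) *\<^sub>R x + t *\<^sub>R y"
    have "(1 - t) * (Phi \<phi> ?p * (x - ?p)) + t * (Phi \<phi> ?p * (y - ?p))
      \<le> (1 - t) * (W_Phi \<phi> x - W_Phi \<phi> ?p) + t * (W_Phi \<phi> y - W_Phi \<phi> ?p)"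
      using t by (intro add_mono mult_left_mono W_Phi_subgradient \<phi>) auto
    then show "W_Phi \<phi> ?p \<le> (1 - t) * W_Phi \<phi> x + t * W_Phi \<phi> y"
      by (simp add: algebra_simps)
  qed simp
  then show "continuous_on UNIV (W_Phi \<phi>)" by (rule convex_on_continuous[rotated]) simp
qed

lemma W_Phi_bounds:
  assumes \<phi>: "communication_protocol \<phi>"
  shows "0 \<le> W_Phi \<phi> x" "W_Phi \<phi> x \<le> Phi \<phi> x * x"
proof -
  have "W_Phi \<phi> 0 = 0" by (simp add: W_Phi_def zero_ereal_def[symmetric])
  then show "0 \<le> W_Phi \<phi> x" "W_Phi \<phi> x \<le> Phi \<phi> x * x"
    using W_Phi_subgradient[OF \<phi>, of 0 x] W_Phi_subgradient[OF \<phi>, of x 0] by simp_all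
qed

interpretation Omega_pair: pair_sigma_finite Omega Omega
proof -
  have "sigma_finite_measure Omega"
    using finite_measure_Omega by (simp add: finite_measure_def)
  then show "pair_sigma_finite Omega Omega" by (simp add: pair_sigma_finite_def)
qed

text \<open>On a product of finite measures a function of one variable stays integrable, so a
  majorant that separates the two labels is enough.\<close>

lemma integrable_Omega_pair_bound:
  fixes h :: "real \<times> real \<Rightarrow> real"
  assumes h: "h \<in> borel_measurable (Omega \<Otimes>\<^sub>M Omega)" and a: "integrable Omega a"
    and bound: "\<And>m \<omega>. \<bar>h (m, \<omega>)\<bar> \<le> C * (a m + a \<omega>)"
  shows "integrable (Omega \<Otimes>\<^sub>M Omega) h"
proof (rule Bochner_Integration.integrable_bound)
  have [measurable]: "a \<in> borel_measurable Omega" using a by simp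
  have 1: "integrable (Omega \<Otimes>\<^sub>M Omega) (\<lambda>p. a (fst p))"
    by (rule Omega_pair.Fubini_integrable) (use a in simp_all)
  have 2: "integrable (Omega \<Otimes>\<^sub>M Omega) (\<lambda>p. a (snd p))"
    by (rule Omega_pair.Fubini_integrable) (use a in simp_all)
  show "integrable (Omega \<Otimes>\<^sub>M Omega) (\<lambda>p. C * (a (fst p) + a (snd p)))"
    using 1 2 by simp
  have "norm (h p) \<le> norm (C * (a (fst p) + a (snd p)))" for p
    using bound[of "fst p" "snd p"] by (cases p) auto
  then show "AE p in Omega \<Otimes>\<^sub>M Omega. norm (h p) \<le> norm (C * (a (fst p) + a (snd p)))" by simp
qed (rule h)

text \<open>The nonlocal term of \<open>Psi\<close>; by oddness of \<open>Phi\<close> it is also a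
  subgradient of the double integral in \<open>energy\<close>, which explains the factor 1/2
  there.\<close>

definition interaction :: "(real \<Rightarrow> real) \<Rightarrow> L2 \<Rightarrow> real \<Rightarrow> real" where
  "interaction \<phi> X m = (\<integral>\<omega>. Phi \<phi> (rep_L2 X m - rep_L2 X \<omega>) \<partial>Omega)"

text \<open>Linear growth and integration in the second label leave a majorant affine in |X(m)|,
  with the L^1 norm of X in its constant.\<close>

lemma square_integrable_interaction:
  assumes \<phi>: "communication_protocol \<phi>"
  shows "square_integrable (interaction \<phi> X)"
proof -
  obtain C where C: "0 \<le> C" "\<And>x. \<bar>Phi \<phi> x\<bar> \<le> C * (1 + \<bar>x\<bar>)"
    using Phi_linear_growth[OF \<phi>] by blast
  let ?x = "rep_L2 X"
  have [measurable]: "Phi \<phi> \<in> borel_measurable borel"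
    by (rule borel_measurable_mono[OF Phi_mono[OF \<phi>]])
  have ix: "integrable Omega ?x" by (simp add: square_integrable_imp_integrable)
  define D where "D = (\<integral>\<omega>. \<bar>?x \<omega>\<bar> \<partial>Omega)"
  have D: "0 \<le> D" by (simp add: D_def)
  show ?thesis
  proof (rule square_integrable_bound)
    show "square_integrable (\<lambda>m. C * (1 + D) + C * \<bar>?x m\<bar>)"
      by (intro square_integrable_add square_integrable_const square_integrable_scale square_integrable_abs) simp
    show "interaction \<phi> X \<in> borel_measurable Omega"
      unfolding interaction_def by measurable
    fix m
    have "\<bar>interaction \<phi> X m\<bar> \<le> (\<integral>\<omega>. \<bar>Phi \<phi> (?x m - ?x \<omega>)\<bar> \<partial>Omega)"
      unfolding interaction_def by (rule integral_abs_bound)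
    also have "\<dots> \<le> (\<integral>\<omega>. C * (1 + \<bar>?x m\<bar>) + C * \<bar>?x \<omega>\<bar> \<partial>Omega)"
    proof (rule integral_mono')
      show "integrable Omega (\<lambda>\<omega>. C * (1 + \<bar>?x m\<bar>) + C * \<bar>?x \<omega>\<bar>)"
        using ix by simp
      fix \<omega>
      have "\<bar>Phi \<phi> (?x m - ?x \<omega>)\<bar> \<le> C * (1 + \<bar>?x m - ?x \<omega>\<bar>)" by (rule C)
      also have "\<dots> \<le> C * (1 + \<bar>?x m\<bar> + \<bar>?x \<omega>\<bar>)"
        using C(1) by (intro mult_left_mono) auto
      finally show "\<bar>Phi \<phi> (?x m - ?x \<omega>)\<bar> \<le> C * (1 + \<bar>?x m\<bar>) + C * \<bar>?x \<omega>\<bar>"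
        by (simp add: algebra_simps)
    qed (use C in simp)
    also have "\<dots> = C * (1 + D) + C * \<bar>?x m\<bar>"
      using ix by (simp add: D_def algebra_simps)
    finally show "\<bar>interaction \<phi> X m\<bar> \<le> \<bar>C * (1 + D) + C * \<bar>?x m\<bar>\<bar>" by simp
  qed
qed

text \<open>Integrating the subgradient inequality for \<open>W_Phi\<close> over pairs; since \<open>Phi\<close> is odd, exchanging the
  two labels turns the difference \<open>Z(m) - Z(\<omega>)\<close> into twice its first term.\<close>

lemma energy_subgradient:
  assumes \<phi>: "communication_protocol \<phi>"
  shows "inner (abs_L2 (interaction \<phi> X) - \<Psi>) (Z - X) \<le> energy \<phi> \<Psi> Z - energy \<phi> \<Psi> X"
proof -
  obtain C where C: "0 \<le> C" "\<And>x. \<bar>Phi \<phi> x\<bar> \<le> C * (1 + \<bar>x\<bar>)"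
    using Phi_linear_growth[OF \<phi>] by blast
  define x where "x = rep_L2 X"
  define z where "z = rep_L2 Z"
  define y where "y m = z m - x m" for m
  have [measurable]: "Phi \<phi> \<in> borel_measurable borel" "W_Phi \<phi> \<in> borel_measurable borel"
    "x \<in> borel_measurable Omega" "z \<in> borel_measurable Omega"
    using borel_measurable_mono[OF Phi_mono[OF \<phi>]] W_Phi_measurable[OF \<phi>] by (simp_all add: x_def z_def)
  have [measurable]: "y \<in> borel_measurable Omega" unfolding y_def by measurable
  have sx: "square_integrable x" and sz: "square_integrable z" by (simp_all add: x_def z_def)
  have sy: "square_integrable y" unfolding y_def by (rule square_integrable_diff[OF sz sx])
  let ?P = "Omega \<Otimes>\<^sub>M Omega"
  have sq: "(a - b)\<^sup>2 \<le> 2 * a\<^sup>2 + 2 * b\<^sup>2" for a b :: real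
    using zero_le_power2[of "a + b"] by (simp add: power2_sum power2_diff)
  have lin: "(1 + \<bar>s\<bar>) * \<bar>t\<bar> \<le> 1 + s\<^sup>2 + t\<^sup>2" for s t :: real
  proof -
    \<comment> \<open>Expanded, this sum is twice the difference of the two sides.\<close>
    have "0 \<le> (1 - \<bar>t\<bar>)\<^sup>2 + (\<bar>s\<bar> - \<bar>t\<bar>)\<^sup>2 + 1 + \<bar>s\<bar>\<^sup>2" by simp
    then show ?thesis by (simp add: power2_diff algebra_simps power2_eq_square[of "\<bar>_\<bar>"])
  qed
  have intW: "integrable ?P (\<lambda>p. W_Phi \<phi> (u (fst p) - u (snd p)))" if u: "square_integrable u" for u
  proof (rule integrable_Omega_pair_bound[where a = "\<lambda>m. 1 + (u m)\<^sup>2" and C = "4 * C"])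
    have [measurable]: "u \<in> borel_measurable Omega" using u by (rule square_integrable_measurable)
    show "(\<lambda>p. W_Phi \<phi> (u (fst p) - u (snd p))) \<in> borel_measurable ?P" by measurable
    show "integrable Omega (\<lambda>m. 1 + (u m)\<^sup>2)" using u by (simp add: square_integrable_def)
    fix m \<omega>
    let ?s = "u m - u \<omega>"
    have "\<bar>W_Phi \<phi> ?s\<bar> \<le> \<bar>Phi \<phi> ?s\<bar> * \<bar>?s\<bar>"
      using W_Phi_bounds[OF \<phi>, of ?s] by (simp flip: abs_mult)
    also have "\<dots> \<le> C * (1 + \<bar>?s\<bar>) * \<bar>?s\<bar>" by (intro mult_right_mono C) simp
    also have "\<dots> \<le> C * (1 + ?s\<^sup>2 + ?s\<^sup>2)"
      using mult_left_mono[OF lin C(1), of ?s ?s] by (simp add: mult.assoc)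
    also have "\<dots> \<le> C * (4 * (1 + (u m)\<^sup>2 + (1 + (u \<omega>)\<^sup>2)))"
      using sq[of "u m" "u \<omega>"] by (intro mult_left_mono C(1)) simp
    finally show "\<bar>W_Phi \<phi> (u (fst (m, \<omega>)) - u (snd (m, \<omega>)))\<bar> \<le> 4 * C * (1 + (u m)\<^sup>2 + (1 + (u \<omega>)\<^sup>2))"
      by (simp add: algebra_simps)
  qed
  \<comment> \<open>The share of the first label in the pairwise subgradient product; exchanging the
    labels gives the other share.\<close>
  define J where "J p = Phi \<phi> (x (fst p) - x (snd p)) * y (fst p)" for p
  have Jm [measurable]: "J \<in> borel_measurable ?P" unfolding J_def by measurable
  have intJ: "integrable ?P J"
  proof (rule integrable_Omega_pair_bound[where a = "\<lambda>m. 1 + (x m)\<^sup>2 + (y m)\<^sup>2" and C = "2 * C"])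
    show "integrable Omega (\<lambda>m. 1 + (x m)\<^sup>2 + (y m)\<^sup>2)" using sx sy by (simp add: square_integrable_def)
    fix m \<omega>
    let ?s = "x m - x \<omega>"
    have "\<bar>J (m, \<omega>)\<bar> = \<bar>Phi \<phi> ?s\<bar> * \<bar>y m\<bar>" by (simp add: J_def abs_mult)
    also have "\<dots> \<le> C * (1 + \<bar>?s\<bar>) * \<bar>y m\<bar>" by (intro mult_right_mono C) simp
    also have "\<dots> \<le> C * (1 + ?s\<^sup>2 + (y m)\<^sup>2)"
      using mult_left_mono[OF lin C(1), of ?s "y m"] by (simp add: mult.assoc)
    also have "\<dots> \<le> C * (2 * (1 + (x m)\<^sup>2 + (y m)\<^sup>2 + (1 + (x \<omega>)\<^sup>2 + (y \<omega>)\<^sup>2)))"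
    proof (rule mult_left_mono[OF _ C(1)])
      show "1 + ?s\<^sup>2 + (y m)\<^sup>2 \<le> 2 * (1 + (x m)\<^sup>2 + (y m)\<^sup>2 + (1 + (x \<omega>)\<^sup>2 + (y \<omega>)\<^sup>2))"
      proof -
        have "1 + s + b \<le> 2 * (1 + p + b + (1 + q + d))"
          if "s \<le> 2 * p + 2 * q" "0 \<le> b" "0 \<le> d" for s p q b d :: real
          using that by simp
        from this[OF sq zero_le_power2 zero_le_power2] show ?thesis .
      qed
    qed
    finally show "\<bar>J (m, \<omega>)\<bar> \<le> 2 * C * (1 + (x m)\<^sup>2 + (y m)\<^sup>2 + (1 + (x \<omega>)\<^sup>2 + (y \<omega>)\<^sup>2))"
      by (simp add: algebra_simps)
  qed (rule Jm)
  have swap: "integrable ?P (\<lambda>(m, \<omega>). J (\<omega>, m))" "(\<integral>(m, \<omega>). J (\<omega>, m) \<partial>?P) = integral\<^sup>L ?P J"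
    using Omega_pair.integrable_product_swap[OF intJ] Omega_pair.integral_product_swap[OF Jm] by auto
  have dbl: "(\<integral>m. (\<integral>\<omega>. W_Phi \<phi> (u m - u \<omega>) \<partial>Omega) \<partial>Omega) = (\<integral>p. W_Phi \<phi> (u (fst p) - u (snd p)) \<partial>?P)"
    if "square_integrable u" for u
    using Omega_pair.integral_fst'[OF intW[OF that]] by simp
  have "2 * integral\<^sup>L ?P J = (\<integral>p. J p + (case p of (m, \<omega>) \<Rightarrow> J (\<omega>, m)) \<partial>?P)"
    using intJ swap by simp
  also have "\<dots> \<le> (\<integral>p. W_Phi \<phi> (z (fst p) - z (snd p)) - W_Phi \<phi> (x (fst p) - x (snd p)) \<partial>?P)"
  proof (rule integral_mono)
    show "integrable ?P (\<lambda>p. J p + (case p of (m, \<omega>) \<Rightarrow> J (\<omega>, m)))" using intJ swap(1) by simp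
    show "integrable ?P (\<lambda>p. W_Phi \<phi> (z (fst p) - z (snd p)) - W_Phi \<phi> (x (fst p) - x (snd p)))"
      using intW[OF sz] intW[OF sx] by simp
    fix p :: "real \<times> real"
    obtain m \<omega> where p: "p = (m, \<omega>)" by (cases p)
    have "Phi \<phi> (x \<omega> - x m) = - Phi \<phi> (x m - x \<omega>)"
      using Phi_minus[OF \<phi>, of "x m - x \<omega>"] by simp
    then have "J (m, \<omega>) + J (\<omega>, m) = Phi \<phi> (x m - x \<omega>) * ((z m - z \<omega>) - (x m - x \<omega>))"
      by (simp add: J_def y_def algebra_simps)
    also have "\<dots> \<le> W_Phi \<phi> (z m - z \<omega>) - W_Phi \<phi> (x m - x \<omega>)" by (rule W_Phi_subgradient[OF \<phi>])
    finally show "J p + (case p of (m, \<omega>) \<Rightarrow> J (\<omega>, m))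
        \<le> W_Phi \<phi> (z (fst p) - z (snd p)) - W_Phi \<phi> (x (fst p) - x (snd p))"
      by (simp add: p)
  qed
  also have "\<dots> = (\<integral>m. (\<integral>\<omega>. W_Phi \<phi> (z m - z \<omega>) \<partial>Omega) \<partial>Omega) - (\<integral>m. (\<integral>\<omega>. W_Phi \<phi> (x m - x \<omega>) \<partial>Omega) \<partial>Omega)"
    using intW[OF sz] intW[OF sx] by (simp add: dbl sx sz)
  finally have W: "integral\<^sup>L ?P J \<le> 1 / 2 * (\<integral>m. (\<integral>\<omega>. W_Phi \<phi> (z m - z \<omega>) \<partial>Omega) \<partial>Omega)
      - 1 / 2 * (\<integral>m. (\<integral>\<omega>. W_Phi \<phi> (x m - x \<omega>) \<partial>Omega) \<partial>Omega)"
    by (simp add: field_simps)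
  \<comment> \<open>Fubini: \<open>y m\<close> is constant in the inner integral, which leaves
    \<open>interaction\<close>.\<close>
  have "integral\<^sup>L ?P J = (\<integral>m. interaction \<phi> X m * y m \<partial>Omega)"
    using Omega_pair.integral_fst'[OF intJ] by (simp add: J_def interaction_def x_def)
  also have "\<dots> = inner (abs_L2 (interaction \<phi> X)) (abs_L2 y)"
    by (rule inner_abs_L2[OF square_integrable_interaction[OF \<phi>] sy, symmetric])
  also have "abs_L2 y = Z - X"
    by (simp add: diff_L2_eq y_def[abs_def] x_def z_def)
  finally have "inner (abs_L2 (interaction \<phi> X)) (Z - X) = integral\<^sup>L ?P J" by simp
  with W show ?thesis
    unfolding energy_def inner_L2_eq_integral[symmetric] x_def z_def
    by (simp add: inner_diff_left inner_diff_right)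
qed

text \<open>For X in the cone, test points outside it impose nothing, since the difference is
  infinite. For X outside, \<open>Xbar\<close> is a test point of finite energy at which the
  difference is minus infinity, so both sets are empty.\<close>

lemma subdifferential_constrained_energy:
  assumes "Xbar \<in> monotone_cone"
  shows "subdifferential (constrained_energy \<phi> \<Psi>) = constrained_subdifferential (energy \<phi> \<Psi>) monotone_cone"
proof (intro ext set_eqI)
  fix X Y
  show "Y \<in> subdifferential (constrained_energy \<phi> \<Psi>) X
      \<longleftrightarrow> Y \<in> constrained_subdifferential (energy \<phi> \<Psi>) monotone_cone X"
  proof (cases "X \<in> monotone_cone")
    case True
    then show ?thesis
      by (auto simp: subdifferential_def constrained_subdifferential_def constrained_energy_def
          indicator_functional_def split: if_splits)
  next
    case False
    have "\<not> ereal (inner Y (Xbar - X)) \<le> constrained_energy \<phi> \<Psi> Xbar - constrained_energy \<phi> \<Psi> X"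
      using False assms by (simp add: constrained_energy_def indicator_functional_def)
    with False show ?thesis
      by (auto simp: subdifferential_def constrained_subdifferential_def)
  qed
qed

theorem theorem4p6:
  fixes \<phi> :: "real \<Rightarrow> real" and Xbar Vbar :: L2
  assumes "communication_protocol \<phi>" and "Xbar \<in> monotone_cone"
  defines "\<V> \<equiv> constrained_energy \<phi> (Psi \<phi> Xbar Vbar)"
  shows "\<exists>X :: real \<Rightarrow> L2.
           gradient_flow \<V> X \<and> X 0 = Xbar \<and> (\<forall>t\<ge>0. X t \<in> monotone_cone) \<and>
           (\<forall>Y. gradient_flow \<V> Y \<and> Y 0 = Xbar \<longrightarrow> (\<forall>t\<ge>0. Y t = X t)) \<and>
           (AE t in lborel. 0 < t \<longrightarrow>
              (\<exists>D. (X has_vector_derivative D) (at t) \<and> minimal_selection \<V> (X t) (- D)))"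
proof -
  define E where "E = energy \<phi> (Psi \<phi> Xbar Vbar)"
  let ?A = "constrained_subdifferential E monotone_cone"
  have grad: "abs_L2 (interaction \<phi> X) - Psi \<phi> Xbar Vbar \<in> ?A X" if "X \<in> monotone_cone" for X
    using that energy_subgradient[OF assms(1)] by (auto simp: constrained_subdifferential_def E_def)
  have sub: "subdifferential \<V> = ?A"
    unfolding \<V>_def E_def by (rule subdifferential_constrained_energy[OF assms(2)])
  interpret maximal_monotone ?A
    using assms(2) grad
    by (intro maximal_monotone_constrained_subdifferential closed_monotone_cone convex_monotone_cone) auto
  \<comment> \<open>This puts the initial datum in the domain of the operator. The element that
    \<open>grad\<close> supplies here is \<open>- Vbar\<close>, as \<open>Psi\<close> is
    \<open>Vbar\<close> plus the interaction term of \<open>Xbar\<close>.\<close>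
  obtain W where W: "W \<in> ?A Xbar"
    using grad[OF assms(2)] by blast
  define X where "X t = flow t Xbar" for t
  have mem: "min_section (X t) \<in> ?A (X t)" if "0 \<le> t" for t
    unfolding X_def by (rule flow_mem(1)[OF W that])
  have AE: "AE t in lborel. 0 < t \<longrightarrow> (X has_vector_derivative - min_section (X t)) (at t)"
    unfolding X_def by (rule AE_flow_has_vector_derivative[OF W])
  have flow: "gradient_flow \<V> X"
    unfolding gradient_flow_def
  proof (intro conjI allI impI)
    show "absolutely_continuous_curve {0..T} X" for T
      by (rule absolutely_continuous_curve_lipschitz[where L = "norm W"])
        (auto simp: dist_norm X_def intro!: flow_lipschitz[OF W])
    show "AE t in lborel. 0 < t \<longrightarrow> (\<exists>D. (X has_vector_derivative D) (at t) \<and> - D \<in> subdifferential \<V> (X t))"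
      using AE
    proof eventually_elim
      case (elim t)
      then show ?case using mem[of t] by (auto simp: sub intro!: exI[of _ "- min_section (X t)"])
    qed
  qed
  have min: "minimal_selection \<V> (X t) (min_section (X t))" if "0 \<le> t" for t
    using mem[OF that] min_section_le[of _ "X t"]
    by (auto simp: minimal_selection_def is_arg_min_def sub not_less)
  have "AE t in lborel. 0 < t \<longrightarrow>
      (\<exists>D. (X has_vector_derivative D) (at t) \<and> minimal_selection \<V> (X t) (- D))"
    using AE
  proof eventually_elim
    case (elim t)
    then show ?case using min[of t] by (auto intro!: exI[of _ "- min_section (X t)"])
  qed
  moreover have "X t \<in> monotone_cone" if "0 \<le> t" for t
    using mem[OF that] by (simp add: constrained_subdifferential_def)
  moreover have X0: "X 0 = Xbar" by (simp add: X_def)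
  moreover have "Y t = X t" if Y: "gradient_flow \<V> Y" "Y 0 = Xbar" and t: "0 \<le> t" for Y t
  proof -
    have "norm (Y t - X t) \<le> norm (Y 0 - X 0)"
      by (rule gradient_flow_nonexpansive[OF _ Y(1) flow t]) (simp add: sub monotone)
    with Y(2) X0 show ?thesis by simp
  qed
  ultimately show ?thesis using flow by blast
qed

end
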